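(* Let $\psi$ be a weakly almost periodic tempered distribution on $\mathbb R^d$. Then there exists a constant $M(\psi)\in\mathbb C$ such that for all $f\in\mathcal D(\mathbb R^d)$, \[ M(\psi*f)=M(\psi)\int_{\mathbb R^d}f\,d\lambda . \]
   Context: $\mathcal D(\mathbb R^d)$ is the space of smooth compactly supported functions, $\lambda$ is Lebesgue measure. For $\psi\in\mathcal S'(\mathbb R^d)$ and $f\in\mathcal S(\mathbb R^d)$, $\psi*f(t):=\psi(T_tf_-)$, $f_-(s)=f(-s)$, $T_tf(x)=f(x-t)$. $\psi$ is weakly almost periodic if $\psi*f$ is a weakly almost periodic function for all $f\in\mathcal S$. For a weakly almost periodic function $g$, its mean is $M(g)=\lim_{R\to\infty}\frac1{\mathrm{vol}(B_R)}\int_{B_R}g\,d\lambda$ (which exists). *)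

theory Defs
  imports "HOL-Analysis.Analysis"
begin

fun pdiffs :: "'a::euclidean_space list \<Rightarrow> ('a \<Rightarrow> complex) \<Rightarrow> 'a \<Rightarrow> complex" where
  "pdiffs [] f = f"
| "pdiffs (i # l) f = (\<lambda>x. vector_derivative (\<lambda>t::real. pdiffs l f (x + t *\<^sub>R i)) (at 0))"

definition smooth_fun :: "('a::euclidean_space \<Rightarrow> complex) \<Rightarrow> bool" where
  "smooth_fun f \<longleftrightarrow>
     (\<forall>l. set l \<subseteq> Basis \<longrightarrow>
        continuous_on UNIV (pdiffs l f) \<and>
        (\<forall>i\<in>Basis. \<forall>x. ((\<lambda>t::real. pdiffs l f (x + t *\<^sub>R i))
                          has_vector_derivative pdiffs (i # l) f x) (at 0)))"

definition schwartz :: "('a::euclidean_space \<Rightarrow> complex) \<Rightarrow> bool" where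
  "schwartz f \<longleftrightarrow> smooth_fun f \<and>
     (\<forall>l (k::nat). set l \<subseteq> Basis \<longrightarrow>
        bounded (range (\<lambda>x. (1 + norm x) ^ k * norm (pdiffs l f x))))"

definition test_fun :: "('a::euclidean_space \<Rightarrow> complex) \<Rightarrow> bool" where
  "test_fun f \<longleftrightarrow> smooth_fun f \<and> compact (closure {x. f x \<noteq> 0})"

definition schwartz_seminorm :: "nat \<Rightarrow> nat \<Rightarrow> ('a::euclidean_space \<Rightarrow> complex) \<Rightarrow> real" where
  "schwartz_seminorm k N f =
     Sup {(1 + norm x) ^ k * norm (pdiffs l f x) | x l. set l \<subseteq> Basis \<and> length l \<le> N}"

text \<open>Tempered distributions: continuous linear functionals on S(R^d)
  (only their values on Schwartz functions matter).\<close>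
definition tempered :: "(('a::euclidean_space \<Rightarrow> complex) \<Rightarrow> complex) \<Rightarrow> bool" where
  "tempered \<psi> \<longleftrightarrow>
     (\<forall>f g. schwartz f \<longrightarrow> schwartz g \<longrightarrow> \<psi> (\<lambda>x. f x + g x) = \<psi> f + \<psi> g) \<and>
     (\<forall>c f. schwartz f \<longrightarrow> \<psi> (\<lambda>x. c * f x) = c * \<psi> f) \<and>
     (\<exists>C k N. \<forall>f. schwartz f \<longrightarrow> norm (\<psi> f) \<le> C * schwartz_seminorm k N f)"

definition dconv :: "(('a::euclidean_space \<Rightarrow> complex) \<Rightarrow> complex) \<Rightarrow> ('a \<Rightarrow> complex) \<Rightarrow> 'a \<Rightarrow> complex" where
  "dconv \<psi> f t = \<psi> (\<lambda>s. f (t - s))"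

definition weak_top_bcont :: "('a::euclidean_space \<Rightarrow>\<^sub>C complex) topology" where
  "weak_top_bcont = topology_generated_by
     {\<phi> -` U | \<phi> U. bounded_linear (\<phi> :: ('a \<Rightarrow>\<^sub>C complex) \<Rightarrow> complex) \<and> open U}"

definition weakly_almost_periodic :: "('a::euclidean_space \<Rightarrow> complex) \<Rightarrow> bool" where
  "weakly_almost_periodic g \<longleftrightarrow> g \<in> bcontfun \<and>
     compactin weak_top_bcont
       (weak_top_bcont closure_of (range (\<lambda>t. Bcontfun (\<lambda>x. g (x - t)))))"

definition wap_distribution :: "(('a::euclidean_space \<Rightarrow> complex) \<Rightarrow> complex) \<Rightarrow> bool" where
  "wap_distribution \<psi> \<longleftrightarrow> tempered \<psi> \<and>
     (\<forall>f. schwartz f \<longrightarrow> weakly_almost_periodic (dconv \<psi> f))"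

definition ball_avg :: "('a::euclidean_space \<Rightarrow> complex) \<Rightarrow> real \<Rightarrow> complex" where
  "ball_avg g R = (LINT x:ball 0 R|lborel. g x) / complex_of_real (measure lborel (ball (0::'a) R))"

definition mean :: "('a::euclidean_space \<Rightarrow> complex) \<Rightarrow> complex" where
  "mean g = Lim at_top (ball_avg g)"

end

theory Submission
  imports Defs
begin

text \<open>
  For a weakly almost periodic \<open>g\<close> the ball averages converge: two distinct limit values would give
  averages \<open>\<nu>\<^sub>i\<close> with \<open>\<nu>\<^sub>i(T\<^sub>x g) \<longlongrightarrow> a\<close> for every translate \<open>T\<^sub>x g\<close>, while \<open>x \<mapsto> \<nu>\<^sub>i(T\<^sub>x g)\<close> stays away
  from \<open>a\<close> in mean. A Fatou-type argument for finitely additive means then yields points \<open>x\<^sub>n\<close> such that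
  every weak cluster point \<open>h\<close> of \<open>T\<^sub>x\<^sub>n g\<close> has \<open>\<nu>\<^sub>i(h)\<close> far from \<open>a\<close> for infinitely many \<open>i\<close>; but a
  limit functional of the \<open>\<nu>\<^sub>i\<close> along these \<open>i\<close> is weakly continuous and equals \<open>a\<close> on the orbit of \<open>g\<close>,
  hence at \<open>h\<close>.

  For test functions, Riemann sums give \<open>\<psi> * (f * g) = (\<psi> * f) * g\<close>, and translation invariance of
  the mean gives \<open>M((\<psi> * f) * g) = M(\<psi> * f) \<integral>g\<close>. Since \<open>f * g = g * f\<close>, it follows that
  \<open>M(\<psi> * f) \<integral>g = M(\<psi> * g) \<integral>f\<close>.
\<close>

text \<open>The difficulty in the existence of the mean is an interchange of limits. The functions
  \<open>x \<mapsto> \<nu>\<^sub>i(T\<^sub>x g)\<close> are convolutions of \<open>g\<close> with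
  probability densities, so each has asymptotically the same ball averages as \<open>g\<close>; yet
  they converge pointwise to \<open>a\<close>. For a countably additive mean, dominated convergence
  would force the value \<open>a\<close>. The means at hand are limits of ball averages along
  filters, only finitely additive, and pointwise convergence says nothing about them. Weak
  compactness of the orbit closure replaces dominated convergence: the failure of the interchange is
  located at points of the orbit, using finitely many indices \<open>i\<close> at a time, and
  therefore survives in a weak cluster point, whose neighbourhoods test finitely many functionals.
  No test function of non-zero integral is constructed. If one exists, it fixes the constant;
  otherwise \<open>|f|^2\<close> shows that every test function vanishes, and any constant
  works.\<close>

subsection \<open>Ball averages\<close>

text \<open>Tychonoff's theorem: the pointwise bounds place all \<open>\<nu> i\<close> in one
  product of closed balls, so a cluster point for pointwise convergence exists, and a refinement of
  \<open>F\<close> converges to it. Linearity and monotonicity of such limits are derived afterwards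
  from those of the averages.\<close>

lemma cluster_functional:
  fixes \<nu> :: "'i \<Rightarrow> 'x \<Rightarrow> 'b::{heine_borel, real_normed_vector}"
  assumes F: "F \<noteq> bot" and bd: "\<And>i x. x \<in> X \<Longrightarrow> norm (\<nu> i x) \<le> B x"
  obtains G \<phi> where "G \<noteq> bot" "G \<le> F" "\<And>x. x \<in> X \<Longrightarrow> ((\<lambda>i. \<nu> i x) \<longlongrightarrow> \<phi> x) G"
proof -
  \<comment> \<open>Outside \<open>X\<close> no bound is known; the value 0 keeps the whole family
    in a compact product.\<close>
  define \<nu>' where "\<nu>' i x = (if x \<in> X then \<nu> i x else 0)" for i x
  define K where "K = PiE UNIV (\<lambda>x. if x \<in> X then cball (0::'b) (B x) else {0})"
  have "compactin (product_topology (\<lambda>x::'x. euclidean :: 'b topology) UNIV) K"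
    unfolding K_def by (subst compactin_PiE) auto
  then have "compact K"
    by (metis compactin_euclidean_iff euclidean_product_topology)
  moreover have "\<nu>' i \<in> K" for i
    using bd by (auto simp: K_def \<nu>'_def)
  then have "eventually (\<lambda>p. p \<in> K) (filtermap \<nu>' F)"
    by (simp add: eventually_filtermap)
  moreover have "filtermap \<nu>' F \<noteq> bot"
    using F by (simp add: filtermap_bot_iff)
  ultimately obtain \<phi> where \<phi>: "inf (nhds \<phi>) (filtermap \<nu>' F) \<noteq> bot"
    unfolding compact_filter by blast
  \<comment> \<open>\<open>G\<close> adds to \<open>F\<close> the pulled-back neighbourhoods of the
    cluster point; being a cluster point means that these are compatible with
    \<open>F\<close>.\<close>
  define G where "G = inf F (filtercomap \<nu>' (nhds \<phi>))"
  have "G \<noteq> bot"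
  proof
    assume "G = bot"
    then have "eventually (\<lambda>_. False) G" by simp
    then obtain P Q where PQ: "eventually P F" "eventually Q (nhds \<phi>)" "\<And>i. P i \<Longrightarrow> Q (\<nu>' i) \<Longrightarrow> False"
      unfolding G_def eventually_inf eventually_filtercomap by blast
    have "eventually (\<lambda>y. \<not> Q y) (filtermap \<nu>' F)"
      using PQ(1) unfolding eventually_filtermap by eventually_elim (use PQ(3) in blast)
    with PQ(2) have "eventually (\<lambda>_. False) (inf (nhds \<phi>) (filtermap \<nu>' F))"
      unfolding eventually_inf by blast
    with \<phi> show False by (simp add: eventually_False)
  qed
  moreover have "G \<le> F" by (simp add: G_def)
  moreover have "((\<lambda>i. \<nu> i x) \<longlongrightarrow> \<phi> x) G" if "x \<in> X" for x
  proof -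
    have "filterlim \<nu>' (nhds \<phi>) G"
      unfolding G_def filterlim_def
      by (metis filtermap_filtercomap filtermap_mono inf.cobounded2 order_trans)
    then have "((\<lambda>i. \<nu>' i x) \<longlongrightarrow> \<phi> x) G"
      using continuous_on_tendsto_compose[OF continuous_on_product_coordinates[of x]] by simp
    with that show ?thesis by (simp add: \<nu>'_def)
  qed
  ultimately show thesis using that by blast
qed

text \<open>Values in any Banach space are allowed, so that averages of \<open>g\<close> and of the
  real function \<open>norm (g x)\<close> obey common rules. For \<open>R \<le> 0\<close> the ball
  is empty and the value is 0, so averages of constants are evaluated for \<open>R > 0\<close>
  only.\<close>

definition bavg :: "('a::euclidean_space \<Rightarrow> 'b::{banach, second_countable_topology}) \<Rightarrow> real \<Rightarrow> 'b" where
  "bavg g R = (LINT x:ball 0 R|lborel. g x) /\<^sub>R measure lborel (ball (0::'a) R)"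

lemma ball_avg_eq_bavg: "ball_avg g = bavg g"
  by (simp add: fun_eq_iff ball_avg_def bavg_def scaleR_conv_of_real divide_inverse mult.commute)

lemma bcontfun_iff: "f \<in> bcontfun \<longleftrightarrow> continuous_on UNIV f \<and> bounded (range f)"
  by (simp add: bcontfun_def)

lemma bcontfun_measurable: "f \<in> bcontfun \<Longrightarrow> f \<in> borel_measurable borel"
  by (auto simp: bcontfun_iff intro: borel_measurable_continuous_onI)

lemma bcontfun_bound:
  fixes f :: "'a::topological_space \<Rightarrow> 'b::real_normed_vector"
  assumes "f \<in> bcontfun" obtains B where "B > 0" "\<And>x. norm (f x) \<le> B"
  using assms unfolding bcontfun_iff bounded_pos by auto

lemma emeasure_ball_finite: "emeasure lborel (ball (c::'a::euclidean_space) R) < \<infinity>"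
  using emeasure_bounded_finite[of "ball c R"] by (simp add: bounded_ball)

lemma bounded_set_integrable:
  fixes g :: "'a::euclidean_space \<Rightarrow> 'b::{banach, second_countable_topology}"
  assumes "g \<in> borel_measurable borel" "\<And>x. norm (g x) \<le> B" "A \<in> sets borel" "bounded A"
  shows "set_integrable lborel A g"
  unfolding set_integrable_def
proof (rule integrableI_bounded_set[where A=A and B=B])
  show "emeasure lborel A < \<infinity>" using emeasure_bounded_finite[OF assms(4)] .
qed (use assms in \<open>auto simp: indicator_def\<close>)

lemma bcontfun_set_integrable:
  fixes g :: "'a::euclidean_space \<Rightarrow> 'b::{banach, second_countable_topology}"
  assumes "g \<in> bcontfun"
  shows "set_integrable lborel (ball c R) g"
  using bcontfun_bound[OF assms] bounded_set_integrable[OF bcontfun_measurable[OF assms]]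
  by (metis bounded_ball borel_open open_ball)

lemma bavg_add:
  assumes "f \<in> bcontfun" "g \<in> bcontfun"
  shows "bavg (\<lambda>x. f x + g x) R = bavg f R + bavg g R"
  unfolding bavg_def using assms by (simp add: set_integral_add bcontfun_set_integrable scaleR_add_right)

lemma bavg_scaleR: "bavg (\<lambda>x. c *\<^sub>R f x) R = c *\<^sub>R bavg f R"
  by (simp add: bavg_def)

lemma bavg_diff:
  assumes "f \<in> bcontfun" "g \<in> bcontfun"
  shows "bavg (\<lambda>x. f x - g x) R = bavg f R - bavg g R"
  unfolding bavg_def using assms by (simp add: set_integral_diff bcontfun_set_integrable scaleR_diff_right)

lemma measure_ball_pos: "R > 0 \<Longrightarrow> measure lborel (ball (c::'a::euclidean_space) R) > 0"
  using content_ball_pos[of R c] by simp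

lemma bavg_const:
  assumes "R > 0"
  shows "bavg (\<lambda>x::'a::euclidean_space. c) R = c"
proof -
  have "(LINT x:ball (0::'a) R|lborel. c) = measure lborel (ball (0::'a) R) *\<^sub>R c"
    unfolding set_lebesgue_integral_def using emeasure_ball_finite[of "0::'a" R]
    by (subst integral_scaleR_left) (auto)
  with measure_ball_pos[OF assms, of "0::'a"] show ?thesis by (simp add: bavg_def)
qed

lemma bavg_mono:
  fixes f g :: "'a::euclidean_space \<Rightarrow> real"
  assumes "f \<in> bcontfun" "g \<in> bcontfun" "\<And>x. f x \<le> g x"
  shows "bavg f R \<le> bavg g R"
  unfolding bavg_def using assms
  by (auto intro!: mult_left_mono set_integral_mono bcontfun_set_integrable)

lemma norm_bcontfun:
  fixes f :: "'a::topological_space \<Rightarrow> 'b::real_normed_vector"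
  assumes "f \<in> bcontfun" shows "(\<lambda>x. norm (f x)) \<in> bcontfun"
  using assms by (auto simp: bcontfun_iff bounded_iff intro: continuous_on_norm)

lemma norm_bavg_le:
  fixes f :: "'a::euclidean_space \<Rightarrow> 'b::{banach, second_countable_topology}"
  assumes "f \<in> bcontfun"
  shows "norm (bavg f R) \<le> bavg (\<lambda>x. norm (f x)) R"
  unfolding bavg_def using set_integral_norm_bound[OF bcontfun_set_integrable[OF assms], of 0 R]
  by (auto intro!: mult_left_mono)

lemma norm_bavg_bound:
  fixes f :: "'a::euclidean_space \<Rightarrow> 'b::{banach, second_countable_topology}"
  assumes "f \<in> bcontfun" "\<And>x. norm (f x) \<le> B" "B \<ge> 0"
  shows "norm (bavg f R) \<le> B"
proof (cases "R > 0")
  case True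
  have "norm (bavg f R) \<le> bavg (\<lambda>x. norm (f x)) R" using norm_bavg_le assms by blast
  also have "\<dots> \<le> bavg (\<lambda>x::'a. B) R"
    by (rule bavg_mono) (use assms in \<open>auto simp: norm_bcontfun const_bcontfun\<close>)
  finally show ?thesis using True by (simp add: bavg_const)
next
  case False
  then have *: "ball (0::'a) R = {}" by auto
  show ?thesis using assms(3) unfolding bavg_def * by simp
qed

section \<open>Invariance of Lebesgue measure and asymptotic invariance of ball averages\<close>

lemma lborel_integral_translate:
  fixes f :: "'a::euclidean_space \<Rightarrow> 'b::{banach, second_countable_topology}"
  assumes "f \<in> borel_measurable borel"
  shows "(LINT x|lborel. f (x - y)) = (LINT x|lborel. f x)"
proof -
  have "(LINT x|lborel. f x) = (LINT x|distr lborel borel ((+) (-y)). f x)"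
    by (simp add: lborel_distr_plus)
  also have "\<dots> = (LINT x|lborel. f (-y + x))"
    using assms by (subst integral_distr) auto
  finally show ?thesis by simp
qed

lemma lborel_distr_reflect: "distr lborel borel (\<lambda>x::'a::euclidean_space. a - x) = lborel"
  using lborel_affine[of "-1" a] by (simp add: density_1)

lemma lborel_integral_reflect:
  fixes f :: "'a::euclidean_space \<Rightarrow> 'b::{banach, second_countable_topology}"
  assumes "f \<in> borel_measurable borel"
  shows "(LINT x|lborel. f (a - x)) = (LINT x|lborel. f x)"
proof -
  have "(LINT x|lborel. f x) = (LINT x|distr lborel borel (\<lambda>x. a - x). f x)"
    by (simp add: lborel_distr_reflect)
  also have "\<dots> = (LINT x|lborel. f (a - x))"
    using assms by (subst integral_distr) auto
  finally show ?thesis by simp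
qed

lemma bavg_reflect:
  assumes "f \<in> borel_measurable borel"
  shows "bavg (\<lambda>x. f (- x)) R = bavg f R"
proof -
  have "(LINT x:ball 0 R|lborel. f (- x)) = (LINT x:ball 0 R|lborel. f x)"
    unfolding set_lebesgue_integral_def
    using lborel_integral_reflect[of "\<lambda>x. indicat_real (ball 0 R) x *\<^sub>R f x" 0] assms
    by (simp add: indicator_def)
  then show ?thesis by (simp add: bavg_def)
qed

text \<open>The integrals cancel on \<open>A\<close>, and on \<open>D - A\<close> the integrand is
  at most \<open>B\<close> in norm. This compares balls with different centres through a ball
  contained in both.\<close>

lemma set_integral_nested_diff:
  fixes f :: "'a::euclidean_space \<Rightarrow> 'b::{banach, second_countable_topology}"
  assumes f: "f \<in> borel_measurable borel" "\<And>x. norm (f x) \<le> B"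
    and A: "A \<in> sets borel" "D \<in> sets borel" "A \<subseteq> D" "bounded D"
  shows "norm ((LINT x:D|lborel. f x) - (LINT x:A|lborel. f x)) \<le> B * (measure lborel D - measure lborel A)"
proof -
  have bA: "bounded A" using A by (meson bounded_subset)
  have iD: "integrable lborel (\<lambda>x. indicat_real D x *\<^sub>R f x)" "integrable lborel (\<lambda>x. indicat_real A x *\<^sub>R f x)"
    using bounded_set_integrable[OF f A(2,4)] bounded_set_integrable[OF f A(1) bA]
    by (simp_all add: set_integrable_def)
  have fin: "emeasure lborel D < \<infinity>" "emeasure lborel A < \<infinity>"
    using emeasure_bounded_finite[OF A(4)] emeasure_bounded_finite[OF bA] by simp_all
  have i: "integrable lborel (\<lambda>x. B * (indicat_real D x - indicat_real A x))"
    using fin A by (intro integrable_mult_right Bochner_Integration.integrable_diff) auto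
  have "(LINT x:D|lborel. f x) - (LINT x:A|lborel. f x)
      = (LINT x|lborel. indicat_real D x *\<^sub>R f x - indicat_real A x *\<^sub>R f x)"
    unfolding set_lebesgue_integral_def using iD by (simp add: Bochner_Integration.integral_diff)
  also have "norm \<dots> \<le> (LINT x|lborel. B * (indicat_real D x - indicat_real A x))"
    by (rule Bochner_Integration.integral_norm_bound_integral)
      (use iD i f A(3) in \<open>auto simp: indicator_def\<close>)
  also have "\<dots> = B * (measure lborel D - measure lborel A)"
    using fin A by (simp add: Bochner_Integration.integral_diff)
  finally show ?thesis .
qed

text \<open>The balls of radius \<open>R\<close> around \<open>0\<close> and \<open>-y\<close> both
  contain the ball of radius \<open>R - norm y\<close> around \<open>0\<close>. Moving the average
  therefore costs at most \<open>2 * B\<close> times the relative volume of a shell, which tends to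
  0.\<close>

lemma bavg_translate_diff:
  fixes f :: "'a::euclidean_space \<Rightarrow> 'b::{banach, second_countable_topology}"
  assumes "f \<in> bcontfun"
  shows "((\<lambda>R. bavg (\<lambda>x. f (x - y)) R - bavg f R) \<longlongrightarrow> 0) at_top"
proof -
  obtain B where B: "B > 0" "\<And>x. norm (f x) \<le> B" using bcontfun_bound[OF assms] by blast
  have mf: "f \<in> borel_measurable borel" using assms by (rule bcontfun_measurable)
  define d where "d = DIM('a)"
  have est: "norm (bavg (\<lambda>x. f (x - y)) R - bavg f R) \<le> 2 * B * (1 - ((R - norm y) / R) ^ d)"
    if R: "R > norm y" for R
  proof -
    have R0: "R > 0" using R norm_ge_zero[of y] by linarith
    let ?A = "ball (0::'a) (R - norm y)"
    let ?m = "\<lambda>S::'a set. measure lborel S"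
    have shift: "(LINT x:ball 0 R|lborel. f (x - y)) = (LINT x:ball (-y) R|lborel. f x)"
    proof -
      have "(LINT x:ball 0 R|lborel. f (x - y)) = (LINT x|lborel. indicat_real (ball (-y) R) (x - y) *\<^sub>R f (x - y))"
        unfolding set_lebesgue_integral_def
        by (intro Bochner_Integration.integral_cong) (auto simp: indicator_def dist_norm norm_minus_commute)
      also have "\<dots> = (LINT x:ball (-y) R|lborel. f x)"
        unfolding set_lebesgue_integral_def
        by (intro lborel_integral_translate[of "\<lambda>x. indicat_real (ball (-y) R) x *\<^sub>R f x"])
          (intro borel_measurable_scaleR borel_measurable_indicator mf, simp)
      finally show ?thesis .
    qed
    have meas: "?m (ball c R) = unit_ball_vol (real d) * R ^ d" for c
      using R0 by (simp add: content_ball d_def)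
    have mA: "?m ?A = unit_ball_vol (real d) * (R - norm y) ^ d"
      using R by (subst content_ball) (auto simp: d_def)
    have sub: "?A \<subseteq> ball c R" if "norm c \<le> norm y" for c
      using that by (auto simp: dist_norm) (smt (verit) norm_triangle_ineq4)
    have nest: "norm ((LINT x:ball c R|lborel. f x) - (LINT x:?A|lborel. f x))
        \<le> B * (?m (ball c R) - ?m ?A)" if "norm c \<le> norm y" for c
      by (rule set_integral_nested_diff) (use mf B sub that in auto)
    have "norm ((LINT x:ball (-y) R|lborel. f x) - (LINT x:ball 0 R|lborel. f x))
        \<le> B * (?m (ball (-y) R) - ?m ?A) + B * (?m (ball 0 R) - ?m ?A)"
      using norm_diff_triangle_le[OF nest[of "-y"], of "LINT x:ball 0 R|lborel. f x"] nest[of 0]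
      by (simp add: norm_minus_commute)
    also have "\<dots> = 2 * B * (unit_ball_vol (real d) * R ^ d - unit_ball_vol (real d) * (R - norm y) ^ d)"
      by (simp only: meas mA)
    finally have *: "norm ((LINT x:ball (-y) R|lborel. f x) - (LINT x:ball 0 R|lborel. f x))
        \<le> 2 * B * (unit_ball_vol (real d) * R ^ d - unit_ball_vol (real d) * (R - norm y) ^ d)" .
    have "bavg (\<lambda>x. f (x - y)) R - bavg f R =
      ((LINT x:ball (-y) R|lborel. f x) - (LINT x:ball 0 R|lborel. f x)) /\<^sub>R (unit_ball_vol (real d) * R ^ d)"
      unfolding bavg_def shift meas by (simp add: scaleR_diff_right)
    also have "norm \<dots> \<le> (2 * B * (unit_ball_vol (real d) * R ^ d - unit_ball_vol (real d) * (R - norm y) ^ d))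
        / (unit_ball_vol (real d) * R ^ d)"
      using * R0 by (simp add: divide_inverse mult.commute mult_left_mono)
    also have "\<dots> = 2 * B * (1 - ((R - norm y) / R) ^ d)"
    proof -
      have "2 * B * (V * a - V * b) / (V * a) = 2 * B * (1 - b / a)" if "V \<noteq> 0" "a \<noteq> 0" for V a b :: real
        using that by (simp add: field_simps)
      moreover have "unit_ball_vol (real d) \<noteq> 0"
        using unit_ball_vol_pos[of "real d"] by (metis less_irrefl of_nat_0_le_iff)
      ultimately show ?thesis using R0 by (simp add: power_divide)
    qed
    finally show ?thesis .
  qed
  have "((\<lambda>R. (R - norm y) / R) \<longlongrightarrow> 1) at_top"
  proof (rule Lim_transform_eventually)
    have "((\<lambda>R. norm y / R) \<longlongrightarrow> 0) at_top"
      by (intro tendsto_divide_0[OF tendsto_const] filterlim_at_top_imp_at_infinity filterlim_ident)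
    then show "((\<lambda>R. 1 - norm y / R) \<longlongrightarrow> 1) at_top"
      using tendsto_diff[OF tendsto_const[of "1::real"]] by fastforce
    show "eventually (\<lambda>R. 1 - norm y / R = (R - norm y) / R) at_top"
      using eventually_gt_at_top[of 0] by eventually_elim (simp add: field_simps)
  qed
  then have "((\<lambda>R. 2 * B * (1 - ((R - norm y) / R) ^ d)) \<longlongrightarrow> 2 * B * (1 - 1 ^ d)) at_top"
    by (intro tendsto_intros)
  then have lim: "((\<lambda>R. 2 * B * (1 - ((R - norm y) / R) ^ d)) \<longlongrightarrow> 0) at_top" by simp
  show ?thesis
    by (rule Lim_null_comparison[OF eventually_mono[OF eventually_gt_at_top[of "norm y"] est] lim])
qed

lemma bcontfun_compose:
  assumes "f \<in> bcontfun" "continuous_on UNIV p"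
  shows "(\<lambda>x. f (p x)) \<in> bcontfun"
  using assms unfolding bcontfun_iff
  by (auto intro: continuous_on_compose2 bounded_subset)

lemma measurable_lborel_pair:
  "f \<in> measurable (borel \<Otimes>\<^sub>M borel) M \<Longrightarrow> f \<in> measurable (lborel \<Otimes>\<^sub>M lborel) M"
  by (subst measurable_cong_sets[OF sets_pair_measure_cong[OF sets_lborel sets_lborel] refl])

text \<open>Fubini's theorem turns the average of the convolution into the \<open>k\<close>-integral
  of averages of translates; these are asymptotically the average of \<open>g\<close>, and dominated
  convergence applies with the bound \<open>norm (k y) * (2 * B)\<close>. The conclusion is about a
  difference because the lemma also serves while convergence of \<open>bavg g\<close> is still to be
  proved.\<close>

lemma bavg_convolution_diff:
  fixes g k :: "'a::euclidean_space \<Rightarrow> complex"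
  assumes g: "g \<in> bcontfun" and k: "integrable lborel k"
  shows "((\<lambda>R. bavg (\<lambda>x. LINT y|lborel. k y * g (x - y)) R - (LINT y|lborel. k y) * bavg g R) \<longlongrightarrow> 0) at_top"
proof -
  obtain B where B: "B > 0" "\<And>x. norm (g x) \<le> B" using bcontfun_bound[OF g] by blast
  have [measurable]: "g \<in> borel_measurable borel" using g by (rule bcontfun_measurable)
  have [measurable]: "k \<in> borel_measurable borel" using k by auto
  have gt: "(\<lambda>x. g (x - y)) \<in> bcontfun" for y
    using g by (rule bcontfun_compose) (intro continuous_intros)
  have swap: "bavg (\<lambda>x. LINT y|lborel. k y * g (x - y)) R = (LINT y|lborel. k y * bavg (\<lambda>x. g (x - y)) R)" for R
  proof -
    let ?h = "\<lambda>x y. indicat_real (ball 0 R) x *\<^sub>R (k y * g (x - y))"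
    have int: "integrable (lborel \<Otimes>\<^sub>M lborel) (case_prod ?h)"
    proof (rule Bochner_Integration.integrable_bound)
      show "integrable (lborel \<Otimes>\<^sub>M lborel) (\<lambda>(x, y). indicat_real (ball (0::'a) R) x * (B * norm (k y)))"
        using k emeasure_ball_finite[of "0::'a" R]
        by (intro lborel_pair.Fubini_integrable, measurable) (auto simp: abs_mult)
      show "AE x in lborel \<Otimes>\<^sub>M lborel. norm (case x of (x, y) \<Rightarrow> ?h x y)
          \<le> norm (case x of (x, y) \<Rightarrow> indicat_real (ball (0::'a) R) x * (B * norm (k y)))"
      proof (rule AE_I2, clarify)
        fix x y
        have "norm (k y * g (x - y)) \<le> B * norm (k y)"
          using mult_right_mono[OF B(2)[of "x - y"], of "norm (k y)"] by (simp add: norm_mult mult.commute)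
        then show "norm (?h x y) \<le> norm (indicat_real (ball (0::'a) R) x * (B * norm (k y)))"
          using B(1) by (simp add: indicator_def)
      qed
      show "case_prod ?h \<in> borel_measurable (lborel \<Otimes>\<^sub>M lborel)"
      proof (rule measurable_lborel_pair)
        have [measurable]: "ball (0::'a) R \<in> sets borel" by simp
        show "case_prod ?h \<in> borel_measurable (borel \<Otimes>\<^sub>M borel)" by measurable
      qed
    qed
    have "(LINT x:ball 0 R|lborel. LINT y|lborel. k y * g (x - y)) = (LINT x|lborel. LINT y|lborel. ?h x y)"
      unfolding set_lebesgue_integral_def by simp
    also have "\<dots> = (LINT y|lborel. LINT x|lborel. ?h x y)"
      by (rule lborel_pair.Fubini_integral[symmetric, OF int])
    also have "\<dots> = (LINT y|lborel. k y * (LINT x:ball 0 R|lborel. g (x - y)))"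
      unfolding set_lebesgue_integral_def by (simp flip: integral_mult_right_zero)
    finally show ?thesis
      unfolding bavg_def by (simp flip: integral_scaleR_right)
  qed
  \<comment> \<open>Measurability in the translation parameter comes from joint measurability of the
    integrand; dominated convergence and the splitting of the integral both rely on it.\<close>
  have mb: "(\<lambda>y. bavg (\<lambda>x. g (x - y)) R) \<in> borel_measurable borel" for R
  proof -
    have [measurable]: "ball (0::'a) R \<in> sets borel" by simp
    have "(\<lambda>(y, x). indicat_real (ball 0 R) x *\<^sub>R g (x - y)) \<in> borel_measurable (borel \<Otimes>\<^sub>M borel)"
      by measurable
    then have [measurable]: "(\<lambda>(y, x). indicat_real (ball 0 R) x *\<^sub>R g (x - y)) \<in> borel_measurable (lborel \<Otimes>\<^sub>M lborel)"
      by (rule measurable_lborel_pair)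
    have "(\<lambda>y. LINT x|lborel. indicat_real (ball 0 R) x *\<^sub>R g (x - y)) \<in> borel_measurable lborel"
      by measurable
    then show ?thesis
      unfolding bavg_def set_lebesgue_integral_def by simp
  qed
  have bb: "norm (bavg (\<lambda>x. g (x - y)) R - bavg g R) \<le> 2 * B" for y R
    using norm_triangle_ineq4[of "bavg (\<lambda>x. g (x - y)) R" "bavg g R"]
      norm_bavg_bound[OF gt[of y], of B R] norm_bavg_bound[OF g, of B R] B by force
  have lim: "((\<lambda>R. LINT y|lborel. k y * (bavg (\<lambda>x. g (x - y)) R - bavg g R)) \<longlongrightarrow> (LINT y|(lborel :: 'a measure). (0::complex))) at_top"
  proof (rule integral_dominated_convergence_at_top[where f = "\<lambda>_. 0" and s = "\<lambda>R y. k y * (bavg (\<lambda>x. g (x - y)) R - bavg g R)" and w = "\<lambda>y. norm (k y) * (2 * B)"])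
    show "\<forall>\<^sub>F R in at_top. AE y in lborel. norm (k y * (bavg (\<lambda>x. g (x - y)) R - bavg g R)) \<le> norm (k y) * (2 * B)"
      using bb by (auto simp: norm_mult intro!: always_eventually mult_left_mono)
    show "AE y in lborel. ((\<lambda>R. k y * (bavg (\<lambda>x. g (x - y)) R - bavg g R)) \<longlongrightarrow> 0) at_top"
      using tendsto_mult_left[OF bavg_translate_diff[OF g]] by auto
  qed (use mb k in auto)
  have "(LINT y|lborel. k y * (bavg (\<lambda>x. g (x - y)) R - bavg g R)) =
      bavg (\<lambda>x. LINT y|lborel. k y * g (x - y)) R - (LINT y|lborel. k y) * bavg g R" for R
  proof -
    have i1: "integrable lborel (\<lambda>y. k y * bavg (\<lambda>x. g (x - y)) R)"
    proof (rule Bochner_Integration.integrable_bound)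
      show "integrable lborel (\<lambda>y. B * norm (k y))" using k by auto
      show "AE y in lborel. norm (k y * bavg (\<lambda>x. g (x - y)) R) \<le> norm (B * norm (k y))"
        using norm_bavg_bound[OF gt, where B = B] B
        by (auto simp: norm_mult mult.commute[of B] intro!: mult_left_mono AE_I2)
    qed (use mb in measurable)
    have "(LINT y|lborel. k y * (bavg (\<lambda>x. g (x - y)) R - bavg g R)) =
      (LINT y|lborel. k y * bavg (\<lambda>x. g (x - y)) R) - (LINT y|lborel. k y * bavg g R)"
      using i1 k by (simp add: algebra_simps)
    then show ?thesis by (simp add: swap)
  qed
  with lim show ?thesis by simp
qed

subsection \<open>Existence of the mean\<close>

text \<open>The maximum over the index window \<open>{j..j + n}\<close>, both ends included. Only
  finite maxima are formed: an infinite supremum of continuous functions may fail to be continuous,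
  and the mean is controlled on bounded continuous functions only.\<close>

primrec run_max :: "(nat \<Rightarrow> 'b \<Rightarrow> real) \<Rightarrow> nat \<Rightarrow> nat \<Rightarrow> 'b \<Rightarrow> real" where
  "run_max H j 0 = H j"
| "run_max H j (Suc n) = (\<lambda>x. max (run_max H j n x) (H (j + Suc n) x))"

lemma run_max_ge: "i \<in> {j..j + n} \<Longrightarrow> H i x \<le> run_max H j n x"
proof (induction n)
  case (Suc n)
  then show ?case by (cases "i = j + Suc n") (auto intro: max.coboundedI1)
qed simp

lemma run_max_attained: "\<exists>i\<in>{j..j + n}. run_max H j n x = H i x"
proof (induction n)
  case (Suc n)
  then obtain i where "i \<in> {j..j + n}" "run_max H j n x = H i x" by blast
  then show ?case
    by (cases "H i x \<le> H (j + Suc n) x") (auto simp: max_def intro: bexI[of _ i] bexI[of _ "Suc (j + n)"])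
qed simp

lemma run_max_mono: "{j..j + n} \<subseteq> {j'..j' + n'} \<Longrightarrow> run_max H j n x \<le> run_max H j' n' x"
  using run_max_attained[of j n H x] run_max_ge[of _ j' n' H x] by fastforce

lemma bcontfun_max:
  fixes f g :: "'a::topological_space \<Rightarrow> real"
  assumes "f \<in> bcontfun" "g \<in> bcontfun"
  shows "(\<lambda>x. max (f x) (g x)) \<in> bcontfun"
proof -
  obtain B C where "\<And>x. norm (f x) \<le> B" "\<And>x. norm (g x) \<le> C"
    using assms bcontfun_bound by metis
  then have "norm (max (f x) (g x)) \<le> max B C" for x
    by (smt (verit, ccfv_threshold) real_norm_def)
  with assms show ?thesis
    unfolding bcontfun_iff by (auto intro!: continuous_on_max boundedI[where B = "max B C"])
qed

lemma bcontfun_run_max: "(\<And>i. H i \<in> bcontfun) \<Longrightarrow> run_max H j n \<in> bcontfun"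
  by (induction n) (auto intro: bcontfun_max)

lemma bcontfun_sum:
  fixes f :: "'i \<Rightarrow> 'a::topological_space \<Rightarrow> 'b::real_normed_vector"
  assumes "\<And>i. i \<in> I \<Longrightarrow> f i \<in> bcontfun"
  shows "(\<lambda>x. \<Sum>i\<in>I. f i x) \<in> bcontfun"
  using assms by (induction I rule: infinite_finite_induct) (auto intro: const_bcontfun plus_cont)

text \<open>A substitute for Fatou's lemma for finitely additive means: \<open>k j\<close> is chosen such that
  \<open>run_max H j (k j)\<close> nearly exhausts the running maxima started at \<open>j\<close>. The minimum of these
  functions over \<open>j \<le> n\<close> then has mean at least \<open>c\<close> minus a small error, so it is not small everywhere.\<close>
lemma mean_selection:
  fixes m :: "('a::topological_space \<Rightarrow> real) \<Rightarrow> real"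
  assumes add: "\<And>f g. f \<in> bcontfun \<Longrightarrow> g \<in> bcontfun \<Longrightarrow> m (\<lambda>x. f x + g x) = m f + m g"
    and mono: "\<And>f g. f \<in> bcontfun \<Longrightarrow> g \<in> bcontfun \<Longrightarrow> (\<And>x. f x \<le> g x) \<Longrightarrow> m f \<le> m g"
    and const: "\<And>r. m (\<lambda>_. r) = r"
    and H: "\<And>i. H i \<in> bcontfun" "\<And>i x. H i x \<le> B" "\<And>i. m (H i) \<ge> c" and c: "c > 0"
  obtains k :: "nat \<Rightarrow> nat" and x :: "nat \<Rightarrow> 'a"
    where "\<And>n j. j \<le> n \<Longrightarrow> \<exists>i\<in>{j..j + k j}. c / 4 \<le> H i (x n)"
proof -
  let ?V = "run_max H"
  have V: "?V j n \<in> bcontfun" for j n using H(1) by (rule bcontfun_run_max)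
  have diff: "m (\<lambda>x. f x - g x) = m f - m g" if "f \<in> bcontfun" "g \<in> bcontfun" for f g
    using add[OF minus_cont[OF that] that(2)] by simp
  have sum: "m (\<lambda>x. \<Sum>i\<in>I. f i x) = (\<Sum>i\<in>I. m (f i))"
    if "\<And>i. f i \<in> bcontfun" "finite I" for f and I :: "nat set"
    using that(2,1)
  proof (induction I rule: finite_induct)
    case (insert i I)
    then show ?case using add[OF insert(4)[of i] bcontfun_sum[of I f]] by simp
  qed (simp add: const)
  have bdd: "bdd_above (range (\<lambda>n. m (?V j n)))" for j
  proof (rule bdd_aboveI2)
    fix n
    have "m (?V j n) \<le> m (\<lambda>_. B)"
    proof (rule mono[OF V const_bcontfun])
      show "?V j n x \<le> B" for x using run_max_attained[of j n H x] H(2) by metis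
    qed
    then show "m (?V j n) \<le> B" by (simp add: const)
  qed
  \<comment> \<open>The errors \<open>c / 2 ^ (j + 2)\<close> add up to less than
    \<open>c / 2\<close>; together with the threshold \<open>c / 4\<close> they stay below
    \<open>c\<close>, which yields the contradiction below.\<close>
  have "\<exists>k. \<forall>n. m (?V j n) \<le> m (?V j k) + c / 2 ^ (j + 2)" for j
  proof -
    have "(SUP n. m (?V j n)) - c / 2 ^ (j + 2) < (SUP n. m (?V j n))" using c by simp
    then obtain k where "(SUP n. m (?V j n)) - c / 2 ^ (j + 2) < m (?V j k)"
      using less_cSUP_iff[OF _ bdd] by blast
    moreover have "m (?V j n) \<le> (SUP n. m (?V j n))" for n
      using bdd by (rule cSUP_upper[rotated]) simp
    ultimately have "m (?V j n) \<le> m (?V j k) + c / 2 ^ (j + 2)" for n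
      by (smt (verit, best))
    then show ?thesis by blast
  qed
  then obtain k where k: "\<And>j n. m (?V j n) \<le> m (?V j (k j)) + c / 2 ^ (j + 2)" by metis
  let ?W = "\<lambda>j. ?V j (k j)"
  have "\<exists>x. \<forall>j\<le>n. c / 4 \<le> ?W j x" for n
  proof (rule ccontr)
    assume neg: "\<not> (\<exists>x. \<forall>j\<le>n. c / 4 \<le> ?W j x)"
    \<comment> \<open>For \<open>j \<le> n\<close> the window \<open>{j..j + K j}\<close> contains
      both \<open>{j..j + k j}\<close> and \<open>{n..n + k n}\<close>: the first inclusion makes
      \<open>D j\<close> non-negative, the second bounds \<open>?W n\<close> by
      \<open>?V j (K j)\<close>.\<close>
    define K where "K j = n + k n + k j" for j
    define D where "D j = (\<lambda>x. ?V j (K j) x - ?W j x)" for j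
    have D: "D j \<in> bcontfun" "m (D j) \<le> c / 2 ^ (j + 2)" for j
      unfolding D_def using minus_cont[OF V V] diff[OF V V] k[of j "K j"] by auto
    have le: "?W n x \<le> c / 4 + (\<Sum>j\<in>{..n}. D j x)" for x
    proof -
      \<comment> \<open>At every point some \<open>?W j\<close> is below the threshold; there
        \<open>?W n\<close> can be large only through the excess \<open>D j\<close>.\<close>
      obtain j where j: "j \<le> n" "?W j x < c / 4" using neg by (meson linorder_not_le)
      have "?W n x \<le> ?V j (K j) x" using j by (intro run_max_mono) (auto simp: K_def)
      then have "?W n x \<le> c / 4 + D j x" using j by (simp add: D_def)
      also have "D j x \<le> (\<Sum>j\<in>{..n}. D j x)"
      proof (rule member_le_sum)
        show "0 \<le> D i x" for i
          unfolding D_def by (simp, rule run_max_mono) (auto simp: K_def)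
      qed (use j in auto)
      finally show ?thesis by simp
    qed
    have "c \<le> m (?W n)"
      using H(3)[of n] mono[OF H(1)[of n] V[of n "k n"]] run_max_ge[of n n "k n" H] by fastforce
    also have "\<dots> \<le> m (\<lambda>x. c / 4 + (\<Sum>j\<in>{..n}. D j x))"
      by (rule mono) (use V D le in \<open>auto intro!: plus_cont bcontfun_sum const_bcontfun\<close>)
    also have "\<dots> = c / 4 + (\<Sum>j\<in>{..n}. m (D j))"
      using add[OF const_bcontfun bcontfun_sum[of "{..n}" D]] D(1) sum[of D "{..n}"] const by simp
    also have "(\<Sum>j\<in>{..n}. m (D j)) \<le> (\<Sum>j\<in>{..n}. c / 2 ^ (j + 2))"
      by (intro sum_mono D)
    also have "\<dots> = (c / 4) * (\<Sum>j<Suc n. (1 / 2) ^ j)"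
      by (simp add: sum_distrib_left power_divide lessThan_Suc_atMost)
    also have "(\<Sum>j<Suc n. (1 / 2 :: real) ^ j) < 2"
      by (subst geometric_sum) (auto simp: field_simps)
    finally show False using c by (simp add: mult_strict_left_mono)
  qed
  then obtain x where x: "\<And>n j. j \<le> n \<Longrightarrow> c / 4 \<le> ?W j (x n)" by metis
  then have "\<exists>i\<in>{j..j + k j}. c / 4 \<le> H i (x n)" if "j \<le> n" for j n
    using that run_max_attained[of j "k j" H "x n"] by metis
  then show thesis using that by blast
qed

section \<open>Weak cluster points and ball averages as weakly continuous functionals\<close>

lemma weak_top_topspace: "topspace (weak_top_bcont :: ('a::euclidean_space \<Rightarrow>\<^sub>C complex) topology) = UNIV"
proof -
  have "(\<lambda>_. 0) -` UNIV \<in> {\<phi> -` U | \<phi> U. bounded_linear (\<phi> :: ('a \<Rightarrow>\<^sub>C complex) \<Rightarrow> complex) \<and> open U}"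
    using bounded_linear_zero by blast
  then show ?thesis by (auto simp: weak_top_bcont_def)
qed

lemma openin_weak_vimage:
  assumes "bounded_linear (\<phi> :: ('a::euclidean_space \<Rightarrow>\<^sub>C complex) \<Rightarrow> complex)" "open U"
  shows "openin weak_top_bcont (\<phi> -` U)"
  unfolding weak_top_bcont_def using assms by (intro topology_generated_by_Basis) blast

text \<open>The closures of the tails have the finite intersection property. The weak topology need
  not be metrizable, so a cluster point takes the place of the limit of a subsequence; the argument
  below tests it against one open set at a time.\<close>

lemma compactin_sequence_cluster:
  fixes u :: "nat \<Rightarrow> 'a"
  assumes C: "compactin X C" "closedin X C" "range u \<subseteq> C"
  obtains h where "h \<in> C" "\<And>U n. openin X U \<Longrightarrow> h \<in> U \<Longrightarrow> \<exists>m\<ge>n. u m \<in> U"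
proof -
  let ?K = "\<lambda>n. X closure_of (u ` {n..})"
  have sub: "?K n \<subseteq> C" for n
    using C by (intro closure_of_minimal) auto
  have top: "C \<subseteq> topspace X" using C(1) compactin_subset_topspace by blast
  have ne: "?K n \<noteq> {}" for n
    using closure_of_subset[of "u ` {n..}" X] C(3) top by auto
  have "C \<inter> \<Inter>(range ?K) \<noteq> {}"
  proof (rule C(1)[unfolded compactin_fip, THEN conjunct2, rule_format], intro conjI allI impI ballI)
    show "closedin X T" if "T \<in> range ?K" for T using that by auto
    fix F assume F: "finite F \<and> F \<subseteq> range ?K"
    then obtain N where N: "finite N" "F = ?K ` N" by (meson finite_subset_image)
    then obtain M where M: "\<forall>n\<in>N. n \<le> M" using finite_nat_set_iff_bounded_le[of N] by auto
    have "?K M \<subseteq> ?K n" if "n \<in> N" for n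
      using M that by (intro closure_of_mono image_mono) auto
    then have "?K M \<subseteq> \<Inter>F" unfolding N(2) by blast
    then show "C \<inter> \<Inter>F \<noteq> {}" using ne[of M] sub[of M] by blast
  qed
  then obtain h where h: "h \<in> C" "\<And>n. h \<in> ?K n" by blast
  show thesis
  proof (rule that[OF h(1)])
    fix U n assume "openin X U" "h \<in> U"
    then show "\<exists>m\<ge>n. u m \<in> U" using h(2)[of n] unfolding in_closure_of by auto
  qed
qed

lemma bavg_bounded_linear:
  "bounded_linear (\<lambda>h :: 'a::euclidean_space \<Rightarrow>\<^sub>C 'b::{banach, second_countable_topology}. bavg (apply_bcontfun h) R)"
proof (rule bounded_linear_intro[where K = 1])
  fix f g :: "'a \<Rightarrow>\<^sub>C 'b" and r :: real
  show "bavg (apply_bcontfun (f + g)) R = bavg (apply_bcontfun f) R + bavg (apply_bcontfun g) R"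
    using bavg_add[OF apply_bcontfun apply_bcontfun, of f g R] by (simp add: plus_bcontfun.rep_eq)
  show "bavg (apply_bcontfun (r *\<^sub>R f)) R = r *\<^sub>R bavg (apply_bcontfun f) R"
    using bavg_scaleR[of r "apply_bcontfun f" R] by (simp add: scaleR_bcontfun.rep_eq)
  show "norm (bavg (apply_bcontfun f) R) \<le> norm f * 1"
    using norm_bavg_bound[OF apply_bcontfun norm_bounded, of f R] by simp
qed

lemma bavg_norm_le: "norm (bavg (apply_bcontfun h) R) \<le> norm h"
  using norm_bavg_bound[OF apply_bcontfun norm_bounded, of h R] by simp

text \<open>Linearity and the norm bound 1 pass to pointwise limits. Limits of ball averages are
  thereby among the functionals that generate the weak topology.\<close>

lemma bounded_linear_tendsto:
  fixes \<nu> :: "'i \<Rightarrow> 'x::real_normed_vector \<Rightarrow> 'b::real_normed_vector"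
  assumes "G \<noteq> bot" "\<And>i. bounded_linear (\<nu> i)" "\<And>i x. norm (\<nu> i x) \<le> norm x"
    and lim: "\<And>x. ((\<lambda>i. \<nu> i x) \<longlongrightarrow> \<phi> x) G"
  shows "bounded_linear \<phi>"
proof (rule bounded_linear_intro[where K = 1])
  fix x y :: 'x and r :: real
  show "\<phi> (x + y) = \<phi> x + \<phi> y"
  proof (rule tendsto_unique[OF assms(1) lim])
    show "((\<lambda>i. \<nu> i (x + y)) \<longlongrightarrow> \<phi> x + \<phi> y) G"
      using tendsto_add[OF lim lim, of x y] assms(2) by (simp add: linear_simps)
  qed
  show "\<phi> (r *\<^sub>R x) = r *\<^sub>R \<phi> x"
  proof (rule tendsto_unique[OF assms(1) lim])
    show "((\<lambda>i. \<nu> i (r *\<^sub>R x)) \<longlongrightarrow> r *\<^sub>R \<phi> x) G"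
      using tendsto_scaleR[OF tendsto_const lim, of r x] assms(2) by (simp add: linear_simps)
  qed
  show "norm (\<phi> x) \<le> norm x * 1"
    using tendsto_upperbound[OF tendsto_norm[OF lim] always_eventually assms(1)] assms(3) by simp
qed

text \<open>The density is the normalised indicator of the ball; its symmetry turns averaging over
  \<open>y + x\<close> into averaging over \<open>x - y\<close>. In this form
  \<open>bavg_convolution_diff\<close> applies to averages of translates as functions of the
  translation.\<close>

lemma bavg_translate_eq_convolution:
  fixes g :: "'a::euclidean_space \<Rightarrow> complex"
  assumes g: "g \<in> bcontfun" and R: "R > 0"
  obtains k where "integrable lborel k" "(LINT y|lborel. k y) = 1"
    "\<And>x. bavg (\<lambda>y. g (y + x)) R = (LINT y|lborel. k y * g (x - y))"
proof -
  define V where "V = measure lborel (ball (0::'a) R)"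
  define k where "k y = complex_of_real (indicat_real (ball (0::'a) R) y / V)" for y
  have V: "V > 0" using measure_ball_pos[OF R, of 0] by (simp add: V_def)
  have fin: "emeasure lborel (ball (0::'a) R) < \<infinity>" by (rule emeasure_ball_finite)
  have mg: "g \<in> borel_measurable borel" using g by (rule bcontfun_measurable)
  have ind: "integrable lborel (indicat_real (ball (0::'a) R))" using fin by auto
  then have ik: "integrable lborel (\<lambda>y. indicat_real (ball (0::'a) R) y / V)"
    by (rule integrable_divide)
  then have "integrable lborel k" unfolding k_def by (rule integrable_of_real)
  moreover have "(LINT y|lborel. k y) = 1"
  proof -
    have "(LINT y|lborel. indicat_real (ball (0::'a) R) y / V) = V / V"
      by (simp only: integral_divide_zero) (simp add: V_def)
    also have "\<dots> = 1" using V by simp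
    finally show ?thesis unfolding k_def integral_complex_of_real by (simp only: of_real_1)
  qed
  moreover have "bavg (\<lambda>y. g (y + x)) R = (LINT y|lborel. k y * g (x - y))" for x
  proof -
    have "bavg (\<lambda>y. g (y + x)) R = bavg (\<lambda>y. g (- y + x)) R"
      by (rule bavg_reflect[symmetric]) (use mg in measurable)
    also have "\<dots> = (LINT y|lborel. k y * g (x - y))"
      unfolding bavg_def set_lebesgue_integral_def V_def[symmetric] k_def
      by (subst integral_scaleR_right[symmetric])
        (auto intro!: Bochner_Integration.integral_cong simp: scaleR_conv_of_real field_simps)
    finally show ?thesis .
  qed
  ultimately show thesis by (rule that)
qed

text \<open>Continuity in the translation is dominated convergence over a ball of finite measure. It
  allows these averages to be averaged again and to be fed to a mean on bounded continuous
  functions.\<close>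

lemma bcontfun_bavg_translate:
  fixes g :: "'a::euclidean_space \<Rightarrow> complex"
  assumes g: "g \<in> bcontfun"
  shows "(\<lambda>x. bavg (\<lambda>y. g (y + x)) R) \<in> bcontfun"
proof (cases "R > 0")
  case True
  obtain B where B: "B > 0" "\<And>x. norm (g x) \<le> B" using bcontfun_bound[OF g] by blast
  have gt: "(\<lambda>y. g (y + x)) \<in> bcontfun" for x
    using g by (rule bcontfun_compose) (intro continuous_intros)
  have mg: "g \<in> borel_measurable borel" using g by (rule bcontfun_measurable)
  have "continuous_on UNIV (\<lambda>x. bavg (\<lambda>y. g (y + x)) R)"
    unfolding continuous_on_eq_continuous_at[OF open_UNIV]
  proof (intro ballI, unfold continuous_at_sequentially, intro allI impI)
    fix a :: 'a and u :: "nat \<Rightarrow> 'a" assume u: "u \<longlonglongrightarrow> a"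
    have "(\<lambda>n. LINT y|lborel. indicat_real (ball 0 R) y *\<^sub>R g (y + u n))
        \<longlonglongrightarrow> (LINT y|lborel. indicat_real (ball 0 R) y *\<^sub>R g (y + a))"
    proof (rule integral_dominated_convergence[where w = "\<lambda>y. B * indicat_real (ball 0 R) y"])
      have [measurable]: "ball (0::'a) R \<in> sets borel" by simp
      have [measurable]: "g \<in> borel_measurable borel" by (rule mg)
      show "(\<lambda>y. indicat_real (ball 0 R) y *\<^sub>R g (y + a)) \<in> borel_measurable lborel"
        "(\<lambda>y. indicat_real (ball 0 R) y *\<^sub>R g (y + u n)) \<in> borel_measurable lborel" for n
        by measurable
      show "integrable lborel (\<lambda>y. B * indicat_real (ball (0::'a) R) y)"
        using emeasure_ball_finite[of "0::'a" R] by (intro integrable_mult_right) auto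
      show "AE y in lborel. (\<lambda>n. indicat_real (ball 0 R) y *\<^sub>R g (y + u n)) \<longlonglongrightarrow> indicat_real (ball 0 R) y *\<^sub>R g (y + a)"
      proof (rule AE_I2, intro tendsto_scaleR tendsto_const)
        fix y
        have "continuous_on UNIV g" using g by (simp add: bcontfun_iff)
        then show "(\<lambda>n. g (y + u n)) \<longlonglongrightarrow> g (y + a)"
          by (rule continuous_on_tendsto_compose) (auto intro!: tendsto_intros u)
      qed
      show "AE y in lborel. norm (indicat_real (ball 0 R) y *\<^sub>R g (y + u n)) \<le> B * indicat_real (ball 0 R) y" for n
        using B by (auto simp: indicator_def)
    qed
    then show "((\<lambda>x. bavg (\<lambda>y. g (y + x)) R) \<circ> u) \<longlonglongrightarrow> bavg (\<lambda>y. g (y + a)) R"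
      unfolding bavg_def set_lebesgue_integral_def o_def by (intro tendsto_scaleR tendsto_const)
  qed
  then show ?thesis
    using norm_bavg_bound[OF gt, where B = B] B by (auto intro: bcontfun_normI)
next
  case False
  then have *: "ball (0::'a) R = {}" by auto
  show ?thesis unfolding bavg_def * by (simp add: const_bcontfun)
qed

lemma weakly_almost_periodic_bavg_convergent:
  fixes g :: "'a::euclidean_space \<Rightarrow> complex"
  assumes wap: "weakly_almost_periodic g"
  shows "\<exists>a. (bavg g \<longlongrightarrow> a) at_top"
proof -
  have g: "g \<in> bcontfun" using wap by (simp add: weakly_almost_periodic_def)
  obtain B where B: "B > 0" "\<And>x. norm (g x) \<le> B" using bcontfun_bound[OF g] by blast
  have gp: "(\<lambda>y. g (y + x)) \<in> bcontfun" for x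
    using g by (rule bcontfun_compose) (intro continuous_intros)
  define T where "T x = Bcontfun (\<lambda>y. g (y + x))" for x
  have T: "apply_bcontfun (T x) = (\<lambda>y. g (y + x))" for x
    unfolding T_def using gp by (rule Bcontfun_inverse)
  let ?X = "weak_top_bcont :: ('a \<Rightarrow>\<^sub>C complex) topology"
  define C where "C = ?X closure_of (range T)"
  \<comment> \<open>The definition of weak almost periodicity translates by \<open>-t\<close>; as
    \<open>t\<close> runs over the whole space, the orbit is the same set.\<close>
  have "range T = range (\<lambda>t. Bcontfun (\<lambda>x. g (x - t)))"
  proof -
    have "(\<lambda>t. Bcontfun (\<lambda>x. g (x - t))) = (\<lambda>t. T (- t))" by (simp add: T_def)
    moreover have "range (\<lambda>t. T (- t)) = range T"
    proof (intro equalityI subsetI)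
      show "y \<in> range (\<lambda>t. T (- t))" if "y \<in> range T" for y
      proof -
        obtain x where "y = T (- (- x))" using \<open>y \<in> range T\<close> by auto
        then show ?thesis by (rule range_eqI)
      qed
    qed auto
    ultimately show ?thesis by (simp only:)
  qed
  then have C: "compactin ?X C" "closedin ?X C" "range T \<subseteq> C"
    using wap unfolding weakly_almost_periodic_def C_def
    by (simp_all add: closure_of_subset weak_top_topspace)
  \<comment> \<open>Some cluster value of the averages exists by boundedness alone. Only the one
    function \<open>g\<close> is tested, hence the singleton.\<close>
  obtain G0 \<phi>0 where G0: "G0 \<noteq> bot" "G0 \<le> at_top" "((\<lambda>R. bavg g R) \<longlongrightarrow> \<phi>0 g) G0"
    using cluster_functional[of at_top "{g}" "\<lambda>R f. bavg f R" "\<lambda>_. B"]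
      norm_bavg_bound[OF g, of B] B by auto
  define a where "a = \<phi>0 g"
  \<comment> \<open>The selection argument uses windows of natural numbers, so the radii are
    extracted as a sequence; \<open>r > real i\<close> makes it tend to infinity.\<close>
  have "\<exists>r. r > real i \<and> norm (bavg g r - a) < 1 / (real i + 1)" for i :: nat
  proof -
    have "eventually (\<lambda>r. r > real i) G0"
      using G0(2) eventually_gt_at_top[of "real i"] by (rule filter_leD)
    moreover have "eventually (\<lambda>r. norm (bavg g r - a) < 1 / (real i + 1)) G0"
      using tendstoD[OF G0(3), of "1 / (real i + 1)"] by (simp add: a_def dist_norm)
    ultimately have "eventually (\<lambda>r. r > real i \<and> norm (bavg g r - a) < 1 / (real i + 1)) G0"
      by eventually_elim simp
    then show ?thesis by (rule eventually_happens'[OF G0(1)])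
  qed
  then obtain R where R: "\<And>i::nat. R i > real i" "\<And>i. norm (bavg g (R i) - a) < 1 / (real i + 1)"
    by metis
  have R0: "R i > 0" for i using R(1)[of i] by (meson of_nat_0_le_iff le_less_trans)
  have Rtop: "filterlim R at_top sequentially"
    by (rule filterlim_at_top_mono[OF filterlim_real_sequentially])
      (use R(1) in \<open>auto intro: always_eventually less_imp_le\<close>)
  have Ra: "(\<lambda>i. bavg g (R i)) \<longlonglongrightarrow> a"
  proof -
    have "(\<lambda>i. bavg g (R i) - a) \<longlonglongrightarrow> 0"
    proof (rule Lim_null_comparison)
      show "\<forall>\<^sub>F i in sequentially. norm (bavg g (R i) - a) \<le> 1 / (real i + 1)"
        using R(2) by (auto intro: always_eventually less_imp_le)
      show "(\<lambda>i. 1 / (real i + 1)) \<longlonglongrightarrow> 0"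
        using LIMSEQ_inverse_real_of_nat by (simp add: inverse_eq_divide add.commute)
    qed
    then show ?thesis by (simp add: LIM_zero_iff)
  qed
  define \<nu> where "\<nu> i h = bavg (apply_bcontfun h) (R i)" for i :: nat and h :: "'a \<Rightarrow>\<^sub>C complex"
  have \<nu>: "bounded_linear (\<nu> i)" "norm (\<nu> i h) \<le> norm h" for i h
    unfolding \<nu>_def by (rule bavg_bounded_linear bavg_norm_le)+
  have \<nu>T: "(\<lambda>i. \<nu> i (T x)) \<longlonglongrightarrow> a" for x
  proof -
    have "(\<lambda>i. bavg (\<lambda>y. g (y + x)) (R i) - bavg g (R i)) \<longlonglongrightarrow> 0"
      using filterlim_compose[OF bavg_translate_diff[OF g, of "-x"] Rtop] by simp
    from tendsto_add[OF this Ra] show ?thesis by (simp add: \<nu>_def T)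
  qed
  define F where "F i x = \<nu> i (T x)" for i x
  have F: "F i \<in> bcontfun" for i
    unfolding F_def \<nu>_def T using bcontfun_bavg_translate[OF g, of "R i"] .
  have FB: "norm (F i x) \<le> B" for i x
    unfolding F_def \<nu>_def T using norm_bavg_bound[OF gp, where B = B] B by auto
  \<comment> \<open>\<open>F i\<close> is a convolution of \<open>g\<close> with a density of mass
    1, so its averages follow those of \<open>g\<close> although \<open>F i\<close> tends to
    \<open>a\<close> pointwise.\<close>
  have Favg: "((\<lambda>r. bavg (F i) r - bavg g r) \<longlongrightarrow> 0) at_top" for i
  proof -
    obtain k where k: "integrable lborel k" "(LINT y|lborel. k y) = 1"
      "\<And>x. bavg (\<lambda>y. g (y + x)) (R i) = (LINT y|lborel. k y * g (x - y))"
      using bavg_translate_eq_convolution[OF g R0] by metis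
    have "F i = (\<lambda>x. LINT y|lborel. k y * g (x - y))"
      by (simp add: fun_eq_iff F_def \<nu>_def T k(3))
    then show ?thesis using bavg_convolution_diff[OF g k(1)] k(2) by simp
  qed
  have "(bavg g \<longlongrightarrow> a) at_top"
  proof (rule ccontr)
    assume "\<not> (bavg g \<longlongrightarrow> a) at_top"
    then obtain e where e: "e > 0" "\<not> eventually (\<lambda>r. dist (bavg g r) a < e) at_top"
      by (auto simp: tendsto_iff)
    \<comment> \<open>Large radii whose averages stay at distance at least \<open>e\<close> from
      \<open>a\<close>; failure of convergence makes this filter proper.\<close>
    define G1 where "G1 = inf at_top (principal {r. dist (bavg g r) a \<ge> e})"
    have G1: "G1 \<noteq> bot"
      using e(2) unfolding G1_def by (simp add: trivial_limit_def eventually_inf_principal not_le)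
    \<comment> \<open>The compactness argument asks for a bound depending on \<open>f\<close> but
      not on the radius.\<close>
    let ?B = "\<lambda>f :: 'a \<Rightarrow> real. SOME b. (\<forall>x. norm (f x) \<le> b) \<and> b > 0"
    have bB: "norm (bavg f r) \<le> ?B f" if "f \<in> bcontfun" for f r
    proof -
      have "\<exists>b. (\<forall>x. norm (f x) \<le> b) \<and> b > 0" using bcontfun_bound[OF that] by metis
      then have "(\<forall>x. norm (f x) \<le> ?B f) \<and> ?B f > 0" by (rule someI_ex)
      then show ?thesis using norm_bavg_bound[OF that, of "?B f" r] by auto
    qed
    obtain G2 and m :: "('a \<Rightarrow> real) \<Rightarrow> real" where G2: "G2 \<noteq> bot" "G2 \<le> G1"
      and m: "\<And>f. f \<in> bcontfun \<Longrightarrow> ((\<lambda>r. bavg f r) \<longlongrightarrow> m f) G2"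
      using cluster_functional[of G1 bcontfun "\<lambda>r f. bavg f r" ?B] G1 bB by metis
    have G2top: "G2 \<le> at_top" using G2(2) by (simp add: G1_def)
    have far: "eventually (\<lambda>r. dist (bavg g r) a \<ge> e) G2"
      using G2(2) by (simp add: G1_def le_principal)
    define H where "H i x = norm (F i x - a)" for i x
    have Fa: "(\<lambda>x. F i x - a) \<in> bcontfun" for i
      using minus_cont[OF F const_bcontfun] .
    have Hb: "H i \<in> bcontfun" for i
      unfolding H_def using norm_bcontfun[OF Fa] .
    have Hle: "H i x \<le> B + norm a" for i x
      unfolding H_def using FB[of i x] norm_triangle_ineq4[of "F i x" a] by linarith
    \<comment> \<open>Along \<open>G2\<close> the averages of \<open>g\<close> stay \<open>e\<close>
      away from \<open>a\<close>, and those of \<open>F i\<close> come within \<open>e / 2\<close>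
      of them; the triangle inequality leaves \<open>e / 2\<close>.\<close>
    have Hm: "m (H i) \<ge> e / 2" for i
    proof (rule tendsto_lowerbound[OF m[OF Hb] _ G2(1)])
      have "eventually (\<lambda>r. norm (bavg (F i) r - bavg g r) < e / 2) at_top"
        using tendstoD[OF Favg, of "e / 2" i] e(1) by (simp add: dist_norm)
      then have "eventually (\<lambda>r. norm (bavg (F i) r - bavg g r) < e / 2) G2"
        using G2top filter_leD by blast
      moreover have "eventually (\<lambda>r. r > 0) G2"
        using G2top filter_leD eventually_gt_at_top by blast
      ultimately show "eventually (\<lambda>r. e / 2 \<le> bavg (H i) r) G2"
        using far
      proof eventually_elim
        case (elim r)
        have "norm (bavg (F i) r - a) = norm (bavg (\<lambda>x. F i x - a) r)"
          using bavg_diff[OF F const_bcontfun, of i a r] elim by (simp add: bavg_const)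
        also have "\<dots> \<le> bavg (H i) r" unfolding H_def by (rule norm_bavg_le[OF Fa])
        finally show ?case
          using elim norm_triangle_ineq4[of "bavg (F i) r - a" "bavg (F i) r - bavg g r"]
          by (simp add: dist_norm)
      qed
    qed
    have madd: "m (\<lambda>x. f x + h x) = m f + m h" if "f \<in> bcontfun" "h \<in> bcontfun" for f h
    proof (rule tendsto_unique[OF G2(1) m[OF plus_cont[OF that]]])
      show "((\<lambda>r. bavg (\<lambda>x. f x + h x) r) \<longlongrightarrow> m f + m h) G2"
        using tendsto_add[OF m[OF that(1)] m[OF that(2)]] by (simp add: bavg_add that)
    qed
    have mmono: "m f \<le> m h" if "f \<in> bcontfun" "h \<in> bcontfun" "\<And>x. f x \<le> h x" for f h
      by (rule tendsto_le[OF G2(1) m[OF that(2)] m[OF that(1)]])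
        (use that in \<open>auto intro!: always_eventually bavg_mono\<close>)
    have mconst: "m (\<lambda>_. r) = r" for r
    proof (rule tendsto_unique[OF G2(1) m[OF const_bcontfun]])
      show "((\<lambda>s. bavg (\<lambda>_::'a. r) s) \<longlongrightarrow> r) G2"
        by (rule tendsto_eventually[OF filter_leD[OF G2top]])
          (rule eventually_mono[OF eventually_gt_at_top[of 0] bavg_const])
    qed
    obtain k x where kx: "\<And>n j. j \<le> n \<Longrightarrow> \<exists>i\<in>{j..j + k j}. e / 2 / 4 \<le> H i (x n)"
      supply that_thesis = that
    proof (rule mean_selection[where m = m and H = H and B = "B + norm a" and c = "e / 2"])
      show "m f \<le> m h" if "f \<in> bcontfun" "h \<in> bcontfun" "\<And>x. f x \<le> h x" for f h
        using that by (rule mmono)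
      show "e / 2 \<le> m (H i)" for i by (rule Hm)
      show thesis if "\<And>n j. j \<le> n \<Longrightarrow> \<exists>i\<in>{j..j + l j}. e / 2 / 4 \<le> H i (z n)" for l z
        using that by (rule that_thesis)
    qed (use e(1) in \<open>simp_all add: madd mconst Hb Hle\<close>)
    \<comment> \<open>The selection was made with \<open>c = e / 2\<close> and has threshold
      \<open>c / 4\<close>.\<close>
    define d where "d = e / 2 / 4"
    have d: "d > 0" using e(1) by (simp add: d_def)
    obtain h where h: "h \<in> C" "\<And>U n. openin ?X U \<Longrightarrow> h \<in> U \<Longrightarrow> \<exists>p\<ge>n. T (x p) \<in> U"
      using compactin_sequence_cluster[of ?X C "\<lambda>n. T (x n)"] C by (auto simp: image_subset_iff)
    \<comment> \<open>The window \<open>{j..j + k j}\<close> does not depend on \<open>p\<close>, so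
      closeness of \<open>\<nu> i h\<close> to \<open>a\<close> for all \<open>i\<close> in it is a
      single weakly open condition on \<open>h\<close>. It passes to some \<open>T (x p)\<close>
      with \<open>p \<ge> j\<close>, where the selection forbids it.\<close>
    have bad: "\<exists>i\<ge>j. norm (\<nu> i h - a) \<ge> d" for j
    proof (rule ccontr)
      assume "\<not> ?thesis"
      then have small: "norm (\<nu> i h - a) < d" if "i \<ge> j" for i using that by force
      define U where "U = (\<Inter>i\<in>{j..j + k j}. \<nu> i -` ball a d)"
      have "openin ?X U" unfolding U_def
        by (intro openin_Inter) (auto intro!: openin_weak_vimage \<nu>)
      moreover have "h \<in> U"
        using small by (auto simp: U_def dist_norm norm_minus_commute)
      ultimately obtain p where p: "p \<ge> j" "T (x p) \<in> U" using h(2)[of U j] by auto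
      obtain i where i: "i \<in> {j..j + k j}" "d \<le> H i (x p)" using kx[OF p(1)] by (auto simp: d_def)
      have "\<nu> i (T (x p)) \<in> ball a d" using p(2) i(1) by (simp add: U_def)
      with i(2) show False
        by (simp add: H_def F_def dist_norm norm_minus_commute)
    qed
    define G3 where "G3 = inf sequentially (principal {i. norm (\<nu> i h - a) \<ge> d})"
    have G3: "G3 \<noteq> bot"
      using bad unfolding G3_def by (auto simp: trivial_limit_def eventually_inf_principal eventually_sequentially)
    obtain G4 \<phi> where G4: "G4 \<noteq> bot" "G4 \<le> G3" and \<phi>: "\<And>f. ((\<lambda>i. \<nu> i f) \<longlongrightarrow> \<phi> f) G4"
      using cluster_functional[of G3 UNIV \<nu> norm] G3 \<nu>(2) by (metis UNIV_I)
    have bl: "bounded_linear \<phi>" by (rule bounded_linear_tendsto[OF G4(1) \<nu> \<phi>])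
    have \<phi>T: "\<phi> (T y) = a" for y
    proof (rule tendsto_unique[OF G4(1) \<phi>])
      have "G4 \<le> sequentially" using G4(2) by (simp add: G3_def)
      then show "((\<lambda>i. \<nu> i (T y)) \<longlongrightarrow> a) G4" using \<nu>T by (rule tendsto_mono)
    qed
    have "d \<le> norm (\<phi> h - a)"
    proof (rule tendsto_lowerbound[OF _ _ G4(1)])
      show "((\<lambda>i. norm (\<nu> i h - a)) \<longlongrightarrow> norm (\<phi> h - a)) G4"
        by (intro tendsto_intros \<phi>)
      show "eventually (\<lambda>i. d \<le> norm (\<nu> i h - a)) G4"
        using G4(2) by (simp add: G3_def le_principal)
    qed
    then have "h \<in> \<phi> -` (- {a})" using d by auto
    then obtain p where "T (x p) \<in> \<phi> -` (- {a})"
      using h(2)[OF openin_weak_vimage[OF bl, of "- {a}"]] by auto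
    with \<phi>T show False by simp
  qed
  then show ?thesis by blast
qed

subsection \<open>Smooth functions and test functions\<close>

lemma pdiffs_append: "pdiffs (l @ l') f = pdiffs l (pdiffs l' f)"
  by (induction l) auto

lemma smooth_fun_continuous: "smooth_fun f \<Longrightarrow> set l \<subseteq> Basis \<Longrightarrow> continuous_on UNIV (pdiffs l f)"
  by (auto simp: smooth_fun_def)

lemma smooth_fun_has_pdiff:
  "smooth_fun f \<Longrightarrow> set l \<subseteq> Basis \<Longrightarrow> i \<in> Basis \<Longrightarrow>
    ((\<lambda>t::real. pdiffs l f (x + t *\<^sub>R i)) has_vector_derivative pdiffs (i # l) f x) (at 0)"
  by (auto simp: smooth_fun_def)

lemma smooth_fun_pdiffs:
  fixes f :: "'a::euclidean_space \<Rightarrow> complex"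
  assumes "smooth_fun f" "set l \<subseteq> Basis"
  shows "smooth_fun (pdiffs l f)"
  unfolding smooth_fun_def
proof (intro allI impI conjI ballI)
  fix l' :: "'a list" and x i :: 'a assume l': "set l' \<subseteq> Basis"
  then have s: "set (l' @ l) \<subseteq> Basis" using assms by simp
  show "continuous_on UNIV (pdiffs l' (pdiffs l f))"
    using smooth_fun_continuous[OF assms(1) s] by (simp add: pdiffs_append)
  assume i: "i \<in> Basis"
  show "((\<lambda>t. pdiffs l' (pdiffs l f) (x + t *\<^sub>R i)) has_vector_derivative pdiffs (i # l') (pdiffs l f) x) (at 0)"
    using smooth_fun_has_pdiff[OF assms(1) s i, of x] by (simp add: pdiffs_append)
qed

lemma pdiffs_eqI:
  assumes "\<And>x. ((\<lambda>t::real. f (x + t *\<^sub>R i)) has_vector_derivative f' x) (at 0)"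
  shows "pdiffs [i] f = f'"
  using assms by (auto simp: fun_eq_iff intro!: vector_derivative_at)

text \<open>Smoothness is the largest class of continuous functions closed under existing partial
  derivatives. Exhibiting an invariant class \<open>P\<close> avoids formulas for iterated
  derivatives.\<close>

lemma smooth_fun_coinduct:
  fixes f :: "'a::euclidean_space \<Rightarrow> complex"
  assumes "P f"
    and step: "\<And>f. P f \<Longrightarrow> continuous_on UNIV f \<and>
      (\<forall>i\<in>Basis. \<exists>f'. P f' \<and> (\<forall>x. ((\<lambda>t::real. f (x + t *\<^sub>R i)) has_vector_derivative f' x) (at 0)))"
  shows "smooth_fun f"
proof -
  have der: "P (pdiffs [i] f) \<and> ((\<lambda>t::real. f (x + t *\<^sub>R i)) has_vector_derivative pdiffs [i] f x) (at 0)"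
    if "P f" "i \<in> Basis" for f i x
    using step[OF that(1)] that(2) pdiffs_eqI by metis
  have P: "P (pdiffs l f)" if "set l \<subseteq> Basis" for l
    using that
  proof (induction l)
    case (Cons i l)
    then have "P (pdiffs [i] (pdiffs l f))" using der by auto
    then show ?case by simp
  qed (simp add: assms)
  show ?thesis unfolding smooth_fun_def
  proof (intro allI impI conjI ballI)
    fix l :: "'a list" and x i :: 'a assume l: "set l \<subseteq> Basis"
    show "continuous_on UNIV (pdiffs l f)" using step[OF P[OF l]] by blast
    assume "i \<in> Basis"
    then show "((\<lambda>t. pdiffs l f (x + t *\<^sub>R i)) has_vector_derivative pdiffs (i # l) f x) (at 0)"
      using der[OF P[OF l], of i x] by simp
  qed
qed

lemma smooth_fun_step:
  assumes "smooth_fun f"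
  shows "continuous_on UNIV f"
    and "i \<in> Basis \<Longrightarrow> smooth_fun (pdiffs [i] f)"
    and "i \<in> Basis \<Longrightarrow> ((\<lambda>t::real. f (x + t *\<^sub>R i)) has_vector_derivative pdiffs [i] f x) (at 0)"
  using smooth_fun_continuous[OF assms, of "[]"] smooth_fun_pdiffs[OF assms, of "[i]"]
    smooth_fun_has_pdiff[OF assms, of "[]" i x] by simp_all

text \<open>The Leibniz rule leads from products to sums of products; this class is closed under
  partial derivatives and serves as the invariant for \<open>smooth_fun_coinduct\<close>.\<close>

inductive product_sum :: "('a::euclidean_space \<Rightarrow> complex) \<Rightarrow> bool" where
  times: "smooth_fun f \<Longrightarrow> smooth_fun g \<Longrightarrow> product_sum (\<lambda>x. f x * g x)"
| plus: "product_sum f \<Longrightarrow> product_sum g \<Longrightarrow> product_sum (\<lambda>x. f x + g x)"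

lemma smooth_fun_times:
  assumes "smooth_fun f" "smooth_fun g"
  shows "smooth_fun (\<lambda>x. f x * g x)"
proof (rule smooth_fun_coinduct[of product_sum])
  show "product_sum (\<lambda>x. f x * g x)" using assms by (rule product_sum.times)
  fix h :: "'a \<Rightarrow> complex" assume "product_sum h"
  then show "continuous_on UNIV h \<and>
      (\<forall>i\<in>Basis. \<exists>f'. product_sum f' \<and> (\<forall>x. ((\<lambda>t::real. h (x + t *\<^sub>R i)) has_vector_derivative f' x) (at 0)))"
  proof induction
    case (times f g)
    have "\<exists>f'. product_sum f' \<and> (\<forall>x. ((\<lambda>t::real. f (x + t *\<^sub>R i) * g (x + t *\<^sub>R i)) has_vector_derivative f' x) (at 0))"
      if i: "i \<in> Basis" for i
    proof (intro exI conjI allI)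
      show "product_sum (\<lambda>x. f x * pdiffs [i] g x + pdiffs [i] f x * g x)"
        by (intro product_sum.intros smooth_fun_step times i)
      show "((\<lambda>t::real. f (x + t *\<^sub>R i) * g (x + t *\<^sub>R i)) has_vector_derivative
          f x * pdiffs [i] g x + pdiffs [i] f x * g x) (at 0)" for x
        using has_vector_derivative_mult[OF smooth_fun_step(3)[OF times(1) i, of x] smooth_fun_step(3)[OF times(2) i, of x]]
        by simp
    qed
    with smooth_fun_step(1)[OF times(1)] smooth_fun_step(1)[OF times(2)] show ?case
      by (auto intro: continuous_on_mult)
  next
    case (plus f g)
    have "\<exists>f'. product_sum f' \<and> (\<forall>x. ((\<lambda>t::real. f (x + t *\<^sub>R i) + g (x + t *\<^sub>R i)) has_vector_derivative f' x) (at 0))"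
      if i: "i \<in> Basis" for i
    proof -
      obtain f' g' where "product_sum f'" "product_sum g'"
        "\<forall>x. ((\<lambda>t::real. f (x + t *\<^sub>R i)) has_vector_derivative f' x) (at 0)"
        "\<forall>x. ((\<lambda>t::real. g (x + t *\<^sub>R i)) has_vector_derivative g' x) (at 0)"
        using plus.IH i by meson
      then show ?thesis
        by (intro exI[of _ "\<lambda>x. f' x + g' x"]) (auto intro: product_sum.plus has_vector_derivative_add)
    qed
    with plus.IH show ?case by (auto intro: continuous_on_add)
  qed
qed

lemma smooth_fun_cnj:
  assumes "smooth_fun f"
  shows "smooth_fun (\<lambda>x. cnj (f x))"
proof (rule smooth_fun_coinduct[of "\<lambda>h. \<exists>f. smooth_fun f \<and> h = (\<lambda>x. cnj (f x))"])
  fix h :: "'a \<Rightarrow> complex" assume "\<exists>f. smooth_fun f \<and> h = (\<lambda>x. cnj (f x))"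
  then obtain f where f: "smooth_fun f" and h: "h = (\<lambda>x. cnj (f x))" by blast
  show "continuous_on UNIV h \<and> (\<forall>i\<in>Basis. \<exists>f'. (\<exists>f. smooth_fun f \<and> f' = (\<lambda>x. cnj (f x))) \<and>
      (\<forall>x. ((\<lambda>t::real. h (x + t *\<^sub>R i)) has_vector_derivative f' x) (at 0)))"
  proof (intro conjI ballI)
    show "continuous_on UNIV h" unfolding h using smooth_fun_step(1)[OF f] by (rule continuous_on_cnj)
    fix i :: 'a assume i: "i \<in> Basis"
    have "\<forall>x. ((\<lambda>t::real. h (x + t *\<^sub>R i)) has_vector_derivative cnj (pdiffs [i] f x)) (at 0)"
      unfolding h using smooth_fun_step(3)[OF f i] has_vector_derivative_cnj by blast
    with smooth_fun_step(2)[OF f i]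
    show "\<exists>f'. (\<exists>f. smooth_fun f \<and> f' = (\<lambda>x. cnj (f x))) \<and>
        (\<forall>x. ((\<lambda>t::real. h (x + t *\<^sub>R i)) has_vector_derivative f' x) (at 0))"
      by blast
  qed
qed (use assms in blast)

lemma smooth_fun_lincomb:
  assumes "smooth_fun f" "smooth_fun g"
  shows "smooth_fun (\<lambda>x. a * f x + b * g x)"
proof (rule smooth_fun_coinduct[of "\<lambda>h. \<exists>f g. smooth_fun f \<and> smooth_fun g \<and> h = (\<lambda>x. a * f x + b * g x)"])
  fix h :: "'a \<Rightarrow> complex" assume "\<exists>f g. smooth_fun f \<and> smooth_fun g \<and> h = (\<lambda>x. a * f x + b * g x)"
  then obtain f g where f: "smooth_fun f" and g: "smooth_fun g" and h: "h = (\<lambda>x. a * f x + b * g x)" by blast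
  show "continuous_on UNIV h \<and> (\<forall>i\<in>Basis. \<exists>f'. (\<exists>f g. smooth_fun f \<and> smooth_fun g \<and> f' = (\<lambda>x. a * f x + b * g x)) \<and>
      (\<forall>x. ((\<lambda>t::real. h (x + t *\<^sub>R i)) has_vector_derivative f' x) (at 0)))"
  proof (intro conjI ballI)
    show "continuous_on UNIV h" unfolding h
      by (intro continuous_intros smooth_fun_step f g)
    fix i :: 'a assume i: "i \<in> Basis"
    have "\<forall>x. ((\<lambda>t::real. h (x + t *\<^sub>R i)) has_vector_derivative a * pdiffs [i] f x + b * pdiffs [i] g x) (at 0)"
      unfolding h by (intro allI has_vector_derivative_add has_vector_derivative_mult_right smooth_fun_step f g i)
    with smooth_fun_step(2)[OF f i] smooth_fun_step(2)[OF g i]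
    show "\<exists>f'. (\<exists>f g. smooth_fun f \<and> smooth_fun g \<and> f' = (\<lambda>x. a * f x + b * g x)) \<and>
        (\<forall>x. ((\<lambda>t::real. h (x + t *\<^sub>R i)) has_vector_derivative f' x) (at 0))" by blast
  qed
qed (use assms in blast)

lemma pdiffs_lincomb:
  assumes "smooth_fun f" "smooth_fun g" "set l \<subseteq> Basis"
  shows "pdiffs l (\<lambda>x. a * f x + b * g x) = (\<lambda>x. a * pdiffs l f x + b * pdiffs l g x)"
  using assms(3)
proof (induction l)
  case (Cons i l)
  have "pdiffs [i] (\<lambda>x. a * pdiffs l f x + b * pdiffs l g x) = (\<lambda>x. a * pdiffs (i # l) f x + b * pdiffs (i # l) g x)"
    by (rule pdiffs_eqI)
      (use Cons.prems assms in \<open>intro has_vector_derivative_add has_vector_derivative_mult_right smooth_fun_has_pdiff, auto\<close>)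
  with Cons show ?case by simp
qed simp

lemma has_vector_derivative_reflect_line:
  fixes f :: "'a::euclidean_space \<Rightarrow> complex"
  assumes "((\<lambda>t::real. f (a - x + t *\<^sub>R i)) has_vector_derivative D) (at 0)"
  shows "((\<lambda>t::real. f (a - (x + t *\<^sub>R i))) has_vector_derivative - D) (at 0)"
proof -
  have "((\<lambda>t::real. - t) has_vector_derivative - 1) (at 0)"
    by (auto intro!: derivative_eq_intros)
  from vector_diff_chain_at[OF this, of "\<lambda>t. f (a - x + t *\<^sub>R i)" D] assms
  show ?thesis by (simp add: o_def algebra_simps)
qed

text \<open>Each derivative contributes a chain-rule factor \<open>-1\<close>. The exact formula
  matters because seminorms of reflected functions are estimated later, where the sign disappears in
  the norm.\<close>

lemma pdiffs_reflect:
  assumes "smooth_fun f" "set l \<subseteq> Basis"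
  shows "pdiffs l (\<lambda>x. f (a - x)) = (\<lambda>x. (-1) ^ length l * pdiffs l f (a - x))"
  using assms(2)
proof (induction l)
  case (Cons i l)
  have "pdiffs [i] (\<lambda>x. (-1) ^ length l * pdiffs l f (a - x)) = (\<lambda>x. (-1) ^ length l * - pdiffs (i # l) f (a - x))"
    by (rule pdiffs_eqI)
      (use Cons.prems assms in \<open>intro has_vector_derivative_mult_right has_vector_derivative_reflect_line smooth_fun_has_pdiff, auto\<close>)
  with Cons show ?case by simp
qed simp

lemma smooth_fun_reflect:
  fixes f :: "'a::euclidean_space \<Rightarrow> complex"
  assumes "smooth_fun f"
  shows "smooth_fun (\<lambda>x. f (a - x))"
  unfolding smooth_fun_def
proof (intro allI impI conjI ballI)
  fix l :: "'a list" and x i :: 'a assume l: "set l \<subseteq> Basis"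
  show "continuous_on UNIV (pdiffs l (\<lambda>x. f (a - x)))"
    unfolding pdiffs_reflect[OF assms l]
    by (intro continuous_on_mult continuous_on_const continuous_on_compose2[OF smooth_fun_continuous[OF assms l]]
        continuous_on_diff continuous_on_id) simp
  assume i: "i \<in> Basis"
  have "((\<lambda>t::real. (-1) ^ length l * pdiffs l f (a - (x + t *\<^sub>R i))) has_vector_derivative
      (-1) ^ length l * - pdiffs (i # l) f (a - x)) (at 0)"
    by (intro has_vector_derivative_mult_right has_vector_derivative_reflect_line smooth_fun_has_pdiff assms l i)
  moreover have "pdiffs (i # l) (\<lambda>x. f (a - x)) x = (-1) ^ length l * - pdiffs (i # l) f (a - x)"
    using pdiffs_reflect[OF assms, of "i # l" a] l i by (simp del: pdiffs.simps)
  ultimately show "((\<lambda>t. pdiffs l (\<lambda>x. f (a - x)) (x + t *\<^sub>R i)) has_vector_derivative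
      pdiffs (i # l) (\<lambda>x. f (a - x)) x) (at 0)"
    unfolding pdiffs_reflect[OF assms l] by (simp del: pdiffs.simps)
qed

section \<open>Compact supports: boundedness, uniform continuity and decay\<close>

lemma compact_closure_support_iff:
  fixes f :: "'a::euclidean_space \<Rightarrow> complex"
  shows "compact (closure {x. f x \<noteq> 0}) \<longleftrightarrow> (\<exists>R. \<forall>x. norm x > R \<longrightarrow> f x = 0)"
proof -
  have "bounded {x. f x \<noteq> 0} \<longleftrightarrow> (\<exists>R. \<forall>x. norm x > R \<longrightarrow> f x = 0)"
    by (auto simp: bounded_iff) (metis not_le)+
  then show ?thesis by (simp add: compact_closure)
qed

lemma test_fun_iff: "test_fun f \<longleftrightarrow> smooth_fun f \<and> (\<exists>R. \<forall>x. norm x > R \<longrightarrow> f x = 0)"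
  unfolding test_fun_def compact_closure_support_iff ..

text \<open>The exterior of a closed ball is open, so near each of its points the function vanishes
  along every line.\<close>

lemma pdiffs_eq_0_outside:
  assumes "\<And>x. norm x > R \<Longrightarrow> f x = 0" "norm x > R"
  shows "pdiffs l f x = 0"
  using assms(2)
proof (induction l arbitrary: x)
  case (Cons i l)
  have "((\<lambda>t::real. pdiffs l f (x + t *\<^sub>R i)) has_vector_derivative 0) (at 0)"
  proof (rule has_vector_derivative_transform_within_open[of "\<lambda>_. 0"])
    have "continuous_on UNIV (\<lambda>t::real. norm (x + t *\<^sub>R i))" by (intro continuous_intros)
    then show "open {t::real. R < norm (x + t *\<^sub>R i)}"
      by (intro open_Collect_less continuous_intros)
  qed (use Cons in auto)
  then show ?case by (auto intro: vector_derivative_at)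
qed (use assms in auto)

lemma test_fun_pdiffs:
  assumes "test_fun f" "set l \<subseteq> Basis" shows "test_fun (pdiffs l f)"
  using assms smooth_fun_pdiffs pdiffs_eq_0_outside unfolding test_fun_iff by metis

lemma compact_support_bounded:
  fixes f :: "'a::euclidean_space \<Rightarrow> 'b::real_normed_vector"
  assumes "continuous_on UNIV f" "\<And>x. norm x > R \<Longrightarrow> f x = 0"
  shows "f \<in> bcontfun"
proof -
  have "bounded (f ` cball 0 R)"
    by (intro compact_imp_bounded compact_continuous_image continuous_on_subset[OF assms(1)]) auto
  then obtain B where "\<forall>y\<in>f ` cball 0 R. norm y \<le> B" unfolding bounded_iff by blast
  then have "norm (f x) \<le> B" if "norm x \<le> R" for x using that by auto
  then have "norm (f x) \<le> max B 0" for x using assms(2)[of x] by (cases "norm x > R") (auto simp: le_max_iff_disj)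
  then show ?thesis using assms(1) by (rule bcontfun_normI[rotated])
qed

lemma compact_support_uniformly_continuous:
  fixes f :: "'a::euclidean_space \<Rightarrow> 'b::real_normed_vector"
  assumes "continuous_on UNIV f" "\<And>x. norm x > R \<Longrightarrow> f x = 0"
  shows "uniformly_continuous_on UNIV f"
  unfolding uniformly_continuous_on_def
proof (intro allI impI)
  fix e :: real assume e: "e > 0"
  \<comment> \<open>With the radius enlarged by 1, two points at distance below 1 either both lie in
    the ball or both have norm above \<open>R\<close>, where \<open>f\<close> vanishes.\<close>
  have "uniformly_continuous_on (cball 0 (R + 1)) f"
    by (intro compact_uniformly_continuous continuous_on_subset[OF assms(1)]) auto
  then obtain d where d: "d > 0" "\<And>x y. x \<in> cball 0 (R + 1) \<Longrightarrow> y \<in> cball 0 (R + 1) \<Longrightarrow> dist y x < d \<Longrightarrow> dist (f y) (f x) < e"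
    using e unfolding uniformly_continuous_on_def by metis
  have "dist (f y) (f x) < e" if "dist y x < min d 1" for x y
  proof (cases "x \<in> cball 0 (R + 1) \<and> y \<in> cball 0 (R + 1)")
    case False
    have "norm x \<le> norm y + dist y x" "norm y \<le> norm x + dist y x"
      by (metis dist_commute dist_norm norm_triangle_sub)+
    with False that have "norm x > R" "norm y > R" by auto
    then show ?thesis using assms(2) e by simp
  qed (use d that in auto)
  then show "\<exists>d>0. \<forall>x\<in>UNIV. \<forall>x'\<in>UNIV. dist x' x < d \<longrightarrow> dist (f x') (f x) < e"
    using d(1) by (intro exI[of _ "min d 1"]) auto
qed

lemma test_fun_bcontfun: "test_fun f \<Longrightarrow> f \<in> bcontfun"
  unfolding test_fun_iff using compact_support_bounded smooth_fun_step(1) by metis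

lemma test_fun_uniformly_continuous: "test_fun f \<Longrightarrow> uniformly_continuous_on UNIV f"
  unfolding test_fun_iff using compact_support_uniformly_continuous smooth_fun_step(1) by metis

lemma test_fun_integrable:
  assumes "test_fun f" shows "integrable lborel f"
proof -
  obtain R where R: "\<And>x. norm x > R \<Longrightarrow> f x = 0" using assms unfolding test_fun_iff by blast
  have "set_integrable lborel (ball 0 (R + 1)) f"
    by (rule bcontfun_set_integrable[OF test_fun_bcontfun[OF assms]])
  moreover have "(\<lambda>x. indicat_real (ball 0 (R + 1)) x *\<^sub>R f x) = f"
  proof
    fix x show "indicat_real (ball 0 (R + 1)) x *\<^sub>R f x = f x"
      using R[of x] by (cases "norm x > R") (auto simp: indicator_def)
  qed
  ultimately show ?thesis by (simp add: set_integrable_def)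
qed

lemma test_fun_schwartz:
  assumes "test_fun f" shows "schwartz f"
  unfolding schwartz_def
proof (intro conjI allI impI)
  show "smooth_fun f" using assms by (simp add: test_fun_def)
  fix l :: "'a list" and k :: nat assume l: "set l \<subseteq> Basis"
  have t: "test_fun (pdiffs l f)" using assms l by (rule test_fun_pdiffs)
  then obtain R where R: "\<And>x. norm x > R \<Longrightarrow> pdiffs l f x = 0" unfolding test_fun_iff by blast
  have "continuous_on UNIV (pdiffs l f)" using t by (simp add: test_fun_iff smooth_fun_step)
  then have "(\<lambda>x. (1 + norm x) ^ k * norm (pdiffs l f x)) \<in> bcontfun"
    by (intro compact_support_bounded[of _ R] continuous_intros) (auto simp: R)
  then show "bounded (range (\<lambda>x. (1 + norm x) ^ k * norm (pdiffs l f x)))" by (simp add: bcontfun_iff)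
qed

lemma test_fun_reflect:
  assumes "test_fun f" shows "test_fun (\<lambda>x. f (a - x))"
proof -
  obtain R where R: "\<And>x. norm x > R \<Longrightarrow> f x = 0" using assms unfolding test_fun_iff by blast
  have "f (a - x) = 0" if "norm x > R + norm a" for x
  proof (rule R)
    show "norm (a - x) > R" using that norm_triangle_ineq2[of x a] by (simp add: norm_minus_commute)
  qed
  then show ?thesis using assms smooth_fun_reflect unfolding test_fun_iff by blast
qed

lemma test_fun_lincomb:
  assumes "test_fun f" "test_fun g" shows "test_fun (\<lambda>x. a * f x + b * g x)"
proof -
  obtain R S where "\<And>x. norm x > R \<Longrightarrow> f x = 0" "\<And>x. norm x > S \<Longrightarrow> g x = 0"
    using assms unfolding test_fun_iff by metis
  then have "a * f x + b * g x = 0" if "norm x > max R S" for x using that by simp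
  then show ?thesis using assms smooth_fun_lincomb unfolding test_fun_iff by blast
qed

section \<open>Differentiation under the integral sign and weighted integrals of translates\<close>

lemma has_vector_derivative_line:
  fixes f :: "'a::euclidean_space \<Rightarrow> complex"
  assumes "smooth_fun f" "i \<in> Basis"
  shows "((\<lambda>t::real. f (x + t *\<^sub>R i)) has_vector_derivative pdiffs [i] f (x + t *\<^sub>R i)) (at t)"
proof -
  have "((\<lambda>s::real. s - t) has_vector_derivative 1) (at t)"
    by (auto intro!: derivative_eq_intros)
  from vector_diff_chain_at[OF this, of "\<lambda>s. f (x + t *\<^sub>R i + s *\<^sub>R i)" "pdiffs [i] f (x + t *\<^sub>R i)"]
    smooth_fun_step(3)[OF assms, of "x + t *\<^sub>R i"]
  show ?thesis by (simp add: o_def algebra_simps del: pdiffs.simps)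
qed

text \<open>The mean value inequality on a segment, combined with uniform continuity of the partial
  derivative, makes the error uniform in \<open>x\<close>. This uniformity justifies differentiating
  under the integral.\<close>

lemma uniform_directional_derivative:
  fixes f :: "'a::euclidean_space \<Rightarrow> complex"
  assumes f: "test_fun f" and i: "i \<in> Basis" and e: "e > 0"
  obtains d where "d > 0"
    "\<And>x t. \<bar>t\<bar> < d \<Longrightarrow> norm (f (x + t *\<^sub>R i) - f x - t *\<^sub>R pdiffs [i] f x) \<le> e * \<bar>t\<bar>"
proof -
  have sf: "smooth_fun f" using f by (simp add: test_fun_def)
  have "uniformly_continuous_on UNIV (pdiffs [i] f)"
    using test_fun_uniformly_continuous[OF test_fun_pdiffs[OF f, of "[i]"]] i by (simp del: pdiffs.simps)
  then obtain d where d: "d > 0" "\<And>x y. dist y x < d \<Longrightarrow> dist (pdiffs [i] f y) (pdiffs [i] f x) < e"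
    using e unfolding uniformly_continuous_on_def by (metis UNIV_I)
  have "norm (f (x + t *\<^sub>R i) - f x - t *\<^sub>R pdiffs [i] f x) \<le> e * \<bar>t\<bar>" if t: "\<bar>t\<bar> < d" for x t
  proof -
    let ?S = "closed_segment 0 t"
    have "norm (f (x + t *\<^sub>R i) - f (x + 0 *\<^sub>R i) - (t - 0) *\<^sub>R pdiffs [i] f (x + 0 *\<^sub>R i)) \<le> norm (t - 0) * e"
    proof (rule vector_differentiable_bound_linearization[of ?S "\<lambda>t. f (x + t *\<^sub>R i)" "\<lambda>s. pdiffs [i] f (x + s *\<^sub>R i)"])
      show "((\<lambda>t. f (x + t *\<^sub>R i)) has_vector_derivative pdiffs [i] f (x + s *\<^sub>R i)) (at s within ?S)" for s
        using has_vector_derivative_line[OF sf i] by (rule has_vector_derivative_at_within)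
      fix s assume "s \<in> ?S"
      then have "\<bar>s\<bar> \<le> \<bar>t\<bar>" by (auto simp: closed_segment_eq_real_ivl split: if_splits)
      then have "dist (x + s *\<^sub>R i) (x + 0 *\<^sub>R i) < d" using t i by (simp add: dist_norm)
      from d(2)[OF this]
      show "norm (pdiffs [i] f (x + s *\<^sub>R i) - pdiffs [i] f (x + 0 *\<^sub>R i)) \<le> e" by (simp add: dist_norm del: pdiffs.simps)
    qed auto
    then show ?thesis by (simp add: mult.commute del: pdiffs.simps)
  qed
  then show thesis using that d(1) by blast
qed

text \<open>With \<open>q = uminus\<close> this is the convolution of \<open>g\<close> and
  \<open>f\<close>; with \<open>q s = - grid n s\<close> it is a Riemann sum for it. A general
  measurable shift \<open>q\<close> settles smoothness, derivatives and supports of both at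
  once.\<close>

definition smear :: "('a::euclidean_space \<Rightarrow> complex) \<Rightarrow> ('a \<Rightarrow> 'a) \<Rightarrow> ('a \<Rightarrow> complex) \<Rightarrow> 'a \<Rightarrow> complex" where
  "smear g q f x = (LINT s|lborel. g s * f (x + q s))"

lemma smear_integrable:
  fixes f :: "'a::euclidean_space \<Rightarrow> complex"
  assumes g: "integrable lborel g" and q: "q \<in> borel_measurable borel" and f: "f \<in> bcontfun"
  shows "integrable lborel (\<lambda>s. g s * f (x + q s))"
proof -
  obtain B where B: "B > 0" "\<And>x. norm (f x) \<le> B" using bcontfun_bound[OF f] by blast
  have [measurable]: "f \<in> borel_measurable borel" "g \<in> borel_measurable borel" "q \<in> borel_measurable borel"
    using g q bcontfun_measurable[OF f] by auto
  show ?thesis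
  proof (rule Bochner_Integration.integrable_bound)
    show "integrable lborel (\<lambda>s. B * norm (g s))" using g by auto
    show "AE s in lborel. norm (g s * f (x + q s)) \<le> norm (B * norm (g s))"
      using B by (auto simp: norm_mult mult.commute[of B] intro!: mult_left_mono AE_I2)
  qed measurable
qed

text \<open>One estimate with two uses: moving the point under a fixed shift gives continuity, and
  changing the shift at a fixed point gives the error of the Riemann sums.\<close>

lemma norm_smear_diff_le:
  fixes f :: "'a::euclidean_space \<Rightarrow> complex"
  assumes g: "integrable lborel g" and q: "p \<in> borel_measurable borel" "q \<in> borel_measurable borel"
    and f: "f \<in> bcontfun" "h \<in> bcontfun"
    and e: "\<And>s. g s \<noteq> 0 \<Longrightarrow> norm (f (x + p s) - h (y + q s)) \<le> e"
  shows "norm (smear g p f x - smear g q h y) \<le> e * (LINT s|lborel. norm (g s))"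
proof -
  note i = smear_integrable[OF g q(1) f(1), of x] smear_integrable[OF g q(2) f(2), of y]
  have "smear g p f x - smear g q h y = (LINT s|lborel. g s * f (x + p s) - g s * h (y + q s))"
    unfolding smear_def using i by simp
  also have "norm \<dots> \<le> (LINT s|lborel. e * norm (g s))"
  proof (rule Bochner_Integration.integral_norm_bound_integral)
    show "norm (g s * f (x + p s) - g s * h (y + q s)) \<le> e * norm (g s)" for s
      using e[of s] by (cases "g s = 0")
        (simp_all add: norm_mult mult.commute[of e] flip: right_diff_distrib)
  qed (use i g in auto)
  finally show ?thesis by simp
qed

lemma smear_has_vector_derivative:
  fixes f :: "'a::euclidean_space \<Rightarrow> complex"
  assumes g: "integrable lborel g" and q: "q \<in> borel_measurable borel" and f: "test_fun f" and i: "i \<in> Basis"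
  shows "((\<lambda>t::real. smear g q f (x + t *\<^sub>R i)) has_vector_derivative smear g q (pdiffs [i] f) x) (at 0)"
  unfolding has_vector_derivative_def has_derivative_at_alt
proof (intro conjI allI impI)
  show "bounded_linear (\<lambda>t. t *\<^sub>R smear g q (pdiffs [i] f) x)" by (rule bounded_linear_scaleR_left)
  fix e :: real assume e: "e > 0"
  define I where "I = (LINT s|lborel. norm (g s))"
  have I: "I \<ge> 0" by (simp add: I_def)
  \<comment> \<open>The added 1 keeps the denominator positive when \<open>g\<close> vanishes almost
    everywhere.\<close>
  define e' where "e' = e / (1 + I)"
  have e': "e' > 0" "e' * I \<le> e" using e I by (simp_all add: e'_def field_simps)
  have d1: "test_fun (pdiffs [i] f)" using i by (intro test_fun_pdiffs[OF f]) simp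
  obtain d where d: "d > 0"
    "\<And>x t. \<bar>t\<bar> < d \<Longrightarrow> norm (f (x + t *\<^sub>R i) - f x - t *\<^sub>R pdiffs [i] f x) \<le> e' * \<bar>t\<bar>"
    using uniform_directional_derivative[OF f i e'(1)] by metis
  have "norm (smear g q f (x + t *\<^sub>R i) - smear g q f x - t *\<^sub>R smear g q (pdiffs [i] f) x) \<le> e * \<bar>t\<bar>"
    if t: "\<bar>t\<bar> < d" for t
  proof -
    note int = smear_integrable[OF g q test_fun_bcontfun[OF f]] smear_integrable[OF g q test_fun_bcontfun[OF d1]]
    have "smear g q f (x + t *\<^sub>R i) - smear g q f x - t *\<^sub>R smear g q (pdiffs [i] f) x =
      (LINT s|lborel. g s * f (x + t *\<^sub>R i + q s) - g s * f (x + q s) - t *\<^sub>R (g s * pdiffs [i] f (x + q s)))"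
      unfolding smear_def using int by (simp del: pdiffs.simps)
    also have "norm \<dots> \<le> (LINT s|lborel. e' * \<bar>t\<bar> * norm (g s))"
    proof (rule Bochner_Integration.integral_norm_bound_integral)
      fix s
      have "g s * f (x + t *\<^sub>R i + q s) - g s * f (x + q s) - t *\<^sub>R (g s * pdiffs [i] f (x + q s))
          = g s * (f ((x + q s) + t *\<^sub>R i) - f (x + q s) - t *\<^sub>R pdiffs [i] f (x + q s))"
        by (simp add: algebra_simps scaleR_conv_of_real del: pdiffs.simps)
      then show "norm (g s * f (x + t *\<^sub>R i + q s) - g s * f (x + q s) - t *\<^sub>R (g s * pdiffs [i] f (x + q s)))
          \<le> e' * \<bar>t\<bar> * norm (g s)"
        using mult_left_mono[OF d(2)[OF t, of "x + q s"], of "norm (g s)"]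
        by (simp add: norm_mult mult_ac del: pdiffs.simps)
    qed (use int g in \<open>auto simp del: pdiffs.simps\<close>)
    also have "\<dots> = (e' * I) * \<bar>t\<bar>" by (simp add: I_def)
    also have "\<dots> \<le> e * \<bar>t\<bar>" using e'(2) by (rule mult_right_mono) simp
    finally show ?thesis .
  qed
  then show "\<exists>d>0. \<forall>t. norm (t - 0) < d \<longrightarrow>
      norm (smear g q f (x + t *\<^sub>R i) - smear g q f (x + 0 *\<^sub>R i) - (t - 0) *\<^sub>R smear g q (pdiffs [i] f) x) \<le> e * norm (t - 0)"
    using d(1) by (intro exI[of _ d]) (simp del: pdiffs.simps)
qed

lemma smear_continuous:
  fixes f :: "'a::euclidean_space \<Rightarrow> complex"
  assumes g: "integrable lborel g" and q: "q \<in> borel_measurable borel" and f: "test_fun f"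
  shows "continuous_on UNIV (smear g q f)"
proof -
  define I where "I = (LINT s|lborel. norm (g s))"
  have I: "I \<ge> 0" by (simp add: I_def)
  have "\<exists>d>0. \<forall>y. dist y x < d \<longrightarrow> dist (smear g q f y) (smear g q f x) < e" if e: "e > 0" for x e
  proof -
    obtain d where d: "d > 0" "\<And>x y. dist y x < d \<Longrightarrow> dist (f y) (f x) < e / (1 + I)"
      using test_fun_uniformly_continuous[OF f] e I unfolding uniformly_continuous_on_def
      by (metis UNIV_I add_pos_nonneg divide_pos_pos zero_less_one)
    have "dist (smear g q f y) (smear g q f x) < e" if y: "dist y x < d" for y
    proof -
      have "norm (smear g q f y - smear g q f x) \<le> e / (1 + I) * I"
        unfolding I_def
      proof (rule norm_smear_diff_le[OF g q q test_fun_bcontfun[OF f] test_fun_bcontfun[OF f]], fold I_def)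
        show "norm (f (y + q s) - f (x + q s)) \<le> e / (1 + I)" for s
          using d(2)[of "y + q s" "x + q s"] y by (simp add: dist_norm)
      qed
      also have "\<dots> < e" using e I by (simp add: field_simps)
      finally show ?thesis by (simp add: dist_norm)
    qed
    with d(1) show ?thesis by blast
  qed
  then show ?thesis by (auto simp: continuous_on_iff)
qed

lemma pdiffs_smear:
  fixes f :: "'a::euclidean_space \<Rightarrow> complex"
  assumes "integrable lborel g" "q \<in> borel_measurable borel" "test_fun f" "set l \<subseteq> Basis"
  shows "pdiffs l (smear g q f) = smear g q (pdiffs l f)"
  using assms(4)
proof (induction l)
  case (Cons i l)
  have "pdiffs [i] (smear g q (pdiffs l f)) = smear g q (pdiffs [i] (pdiffs l f))"
    by (rule pdiffs_eqI, rule smear_has_vector_derivative)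
      (use Cons.prems assms test_fun_pdiffs in auto)
  with Cons show ?case by simp
qed simp

lemma smooth_fun_smear:
  fixes f :: "'a::euclidean_space \<Rightarrow> complex"
  assumes "integrable lborel g" "q \<in> borel_measurable borel" "test_fun f"
  shows "smooth_fun (smear g q f)"
  unfolding smooth_fun_def
proof (intro allI impI conjI ballI)
  fix l :: "'a list" and x i :: 'a assume l: "set l \<subseteq> Basis"
  show "continuous_on UNIV (pdiffs l (smear g q f))"
    unfolding pdiffs_smear[OF assms l] by (rule smear_continuous[OF assms(1,2) test_fun_pdiffs[OF assms(3) l]])
  assume i: "i \<in> Basis"
  then have il: "set (i # l) \<subseteq> Basis" using l by simp
  show "((\<lambda>t. pdiffs l (smear g q f) (x + t *\<^sub>R i)) has_vector_derivative pdiffs (i # l) (smear g q f) x) (at 0)"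
    unfolding pdiffs_smear[OF assms l] pdiffs_smear[OF assms il]
    using smear_has_vector_derivative[OF assms(1,2) test_fun_pdiffs[OF assms(3) l] i, of x] by simp
qed

lemma smear_eq_0:
  fixes f :: "'a::euclidean_space \<Rightarrow> complex"
  assumes "\<And>s. g s \<noteq> 0 \<Longrightarrow> norm (q s) \<le> Q" "\<And>x. norm x > R \<Longrightarrow> f x = 0" "norm x > R + Q"
  shows "smear g q f x = 0"
proof -
  have "g s * f (x + q s) = 0" for s
  proof (cases "g s = 0")
    case False
    have "norm (x + q s) > R" using assms(1)[OF False] assms(3) norm_diff_ineq[of x "q s"] by linarith
    then show ?thesis using assms(2) by simp
  qed simp
  then have "(\<lambda>s. g s * f (x + q s)) = (\<lambda>_. 0)" by (rule ext)
  then show ?thesis by (simp add: smear_def)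
qed

lemma test_fun_smear:
  fixes f :: "'a::euclidean_space \<Rightarrow> complex"
  assumes "integrable lborel g" "q \<in> borel_measurable borel" "test_fun f"
    and "\<And>s. g s \<noteq> 0 \<Longrightarrow> norm (q s) \<le> Q"
  shows "test_fun (smear g q f)"
proof -
  obtain R where "\<And>x. norm x > R \<Longrightarrow> f x = 0" using assms(3) unfolding test_fun_iff by blast
  from smear_eq_0[of g q Q R f, OF assms(4) this] show ?thesis
    using smooth_fun_smear[OF assms(1-3)] unfolding test_fun_iff by blast
qed

section \<open>Seminorm bounds, grids and finite sums for tempered functionals\<close>

lemma tempered_bound:
  assumes "tempered \<psi>"
  obtains K :: real and k N where "K \<ge> 0"
    "\<And>f B. schwartz f \<Longrightarrow> (\<And>l x. set l \<subseteq> Basis \<Longrightarrow> length l \<le> N \<Longrightarrow> (1 + norm x) ^ k * norm (pdiffs l f x) \<le> B)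
      \<Longrightarrow> norm (\<psi> f) \<le> K * B"
proof -
  obtain C k N where C: "\<And>f. schwartz f \<Longrightarrow> norm (\<psi> f) \<le> C * schwartz_seminorm k N f"
    using assms unfolding tempered_def by blast
  \<comment> \<open>\<open>C\<close> may be negative. Passing to its absolute value uses that the
    seminorm is non-negative, which the entry at \<open>0\<close> with no derivatives shows; the
    bound \<open>B\<close> also makes the set under the supremum bounded above.\<close>
  have "norm (\<psi> f) \<le> \<bar>C\<bar> * B" if f: "schwartz f"
    and B: "\<And>l x. set l \<subseteq> Basis \<Longrightarrow> length l \<le> N \<Longrightarrow> (1 + norm x) ^ k * norm (pdiffs l f x) \<le> B" for f B
  proof -
    let ?S = "{(1 + norm x) ^ k * norm (pdiffs l f x) | x l. set l \<subseteq> Basis \<and> length l \<le> N}"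
    have mem: "(1 + norm (0::'a)) ^ k * norm (pdiffs [] f 0) \<in> ?S"
      by (rule CollectI, intro exI[of _ 0] exI[of _ "[]"]) simp
    have "bdd_above ?S" using B by (intro bdd_aboveI[of _ B]) blast
    from cSup_upper[OF mem this] have "0 \<le> schwartz_seminorm k N f"
      unfolding schwartz_seminorm_def by (rule order_trans[rotated]) simp
    moreover have "schwartz_seminorm k N f \<le> B"
      unfolding schwartz_seminorm_def using mem B by (intro cSup_least) blast+
    ultimately have "C * schwartz_seminorm k N f \<le> \<bar>C\<bar> * B" by (intro mult_mono) auto
    with C[OF f] show ?thesis by linarith
  qed
  then show thesis using that[of "\<bar>C\<bar>" N k] by simp
qed

text \<open>A step function approximating the identity uniformly, with finitely many values on
  bounded sets, so that integrals of functions of \<open>grid n s\<close> against compactly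
  supported weights are finite sums. The successor excludes a zero denominator.\<close>

definition grid :: "nat \<Rightarrow> 'a::euclidean_space \<Rightarrow> 'a" where
  "grid n s = (\<Sum>b\<in>Basis. (of_int \<lfloor>real (Suc n) * (s \<bullet> b)\<rfloor> / real (Suc n)) *\<^sub>R b)"

lemma grid_measurable [measurable]: "grid n \<in> borel_measurable borel"
  unfolding grid_def by measurable

lemma norm_grid_diff: "norm (grid n s - (s::'a::euclidean_space)) \<le> real DIM('a) / real (Suc n)"
proof -
  have "grid n s - s = (\<Sum>b\<in>Basis. (of_int \<lfloor>real (Suc n) * (s \<bullet> b)\<rfloor> / real (Suc n) - s \<bullet> b) *\<^sub>R b)"
    unfolding grid_def by (subst (2) euclidean_representation[of s, symmetric])
      (simp only: scaleR_diff_left sum_subtractf)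
  also have "norm \<dots> \<le> (\<Sum>b\<in>(Basis::'a set). 1 / real (Suc n))"
  proof (rule sum_norm_le)
    fix b :: 'a assume b: "b \<in> Basis"
    have "of_int \<lfloor>real (Suc n) * (s \<bullet> b)\<rfloor> / real (Suc n) - s \<bullet> b
        = (of_int \<lfloor>real (Suc n) * (s \<bullet> b)\<rfloor> - real (Suc n) * (s \<bullet> b)) / real (Suc n)"
      by (simp add: field_simps)
    moreover have "\<bar>of_int \<lfloor>real (Suc n) * (s \<bullet> b)\<rfloor> - real (Suc n) * (s \<bullet> b)\<bar> \<le> 1" by linarith
    ultimately show "norm ((of_int \<lfloor>real (Suc n) * (s \<bullet> b)\<rfloor> / real (Suc n) - s \<bullet> b) *\<^sub>R b) \<le> 1 / real (Suc n)"
      using b by (simp add: divide_right_mono)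
  qed
  finally show ?thesis by simp
qed

lemma finite_grid_image: "finite (grid n ` cball (0::'a::euclidean_space) S)"
proof -
  define M where "M = \<lceil>real (Suc n) * \<bar>S\<bar>\<rceil> + 1"
  let ?P = "PiE (Basis::'a set) (\<lambda>_. {- M..M})"
  have "grid n ` cball (0::'a) S \<subseteq> (\<lambda>\<phi>. \<Sum>b\<in>Basis. (of_int (\<phi> b) / real (Suc n)) *\<^sub>R b) ` ?P"
  proof (rule image_subsetI)
    fix s :: 'a assume s: "s \<in> cball 0 S"
    let ?\<phi> = "restrict (\<lambda>b. \<lfloor>real (Suc n) * (s \<bullet> b)\<rfloor>) Basis"
    have "?\<phi> \<in> ?P"
    proof (rule restrict_PiE_iff[THEN iffD2], rule ballI)
      fix b :: 'a assume b: "b \<in> Basis"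
      have "\<bar>s \<bullet> b\<bar> \<le> \<bar>S\<bar>" using s Basis_le_norm[OF b, of s] by simp
      then have "\<bar>real (Suc n) * (s \<bullet> b)\<bar> \<le> real (Suc n) * \<bar>S\<bar>"
        by (simp only: abs_mult) (simp add: mult_left_mono)
      then show "\<lfloor>real (Suc n) * (s \<bullet> b)\<rfloor> \<in> {- M..M}" unfolding M_def by (auto simp del: of_nat_Suc) linarith+
    qed
    moreover have "grid n s = (\<Sum>b\<in>Basis. (of_int (?\<phi> b) / real (Suc n)) *\<^sub>R b)"
      unfolding grid_def by (intro sum.cong) auto
    ultimately show "grid n s \<in> (\<lambda>\<phi>. \<Sum>b\<in>Basis. (of_int (\<phi> b) / real (Suc n)) *\<^sub>R b) ` ?P" by blast
  qed
  moreover have "finite ?P" by (intro finite_PiE) auto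
  ultimately show ?thesis by (meson finite_imageI finite_subset)
qed

text \<open>\<open>\<Phi> (p s)\<close> is constant on each fibre of \<open>p\<close>. The weights
  depend on \<open>g\<close> and \<open>p\<close> only, so that the same ones occur for translates
  of \<open>f\<close> and for values of \<open>dconv \<psi> f\<close>.\<close>

lemma integral_finite_range:
  fixes g \<Phi> :: "'a::euclidean_space \<Rightarrow> complex"
  assumes g: "integrable lborel g" and p: "p \<in> borel_measurable borel" and A: "finite A" "\<And>s. g s \<noteq> 0 \<Longrightarrow> p s \<in> A"
  shows "(LINT s|lborel. g s * \<Phi> (p s)) = (\<Sum>c\<in>A. (LINT s|lborel. indicat_real (p -` {c}) s *\<^sub>R g s) * \<Phi> c)"
proof -
  have i: "integrable lborel (\<lambda>s. indicat_real (p -` {c}) s *\<^sub>R g s)" for c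
  proof (rule integrable_mult_indicator[OF _ g])
    show "p -` {c} \<in> sets lborel" using measurable_sets[OF p, of "{c}"] by simp
  qed
  have "g s * \<Phi> (p s) = (\<Sum>c\<in>A. (indicat_real (p -` {c}) s *\<^sub>R g s) * \<Phi> c)" for s
  proof (cases "g s = 0")
    case False
    have "(\<Sum>c\<in>A. (indicat_real (p -` {c}) s *\<^sub>R g s) * \<Phi> c) = (\<Sum>c\<in>A. if c = p s then g s * \<Phi> c else 0)"
      by (intro sum.cong) (auto simp: indicator_def)
    with A False show ?thesis by (simp add: sum.delta)
  qed simp
  then have "(LINT s|lborel. g s * \<Phi> (p s)) = (LINT s|lborel. (\<Sum>c\<in>A. (indicat_real (p -` {c}) s *\<^sub>R g s) * \<Phi> c))" by simp
  also have "\<dots> = (\<Sum>c\<in>A. (LINT s|lborel. indicat_real (p -` {c}) s *\<^sub>R g s) * \<Phi> c)"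
    by (subst Bochner_Integration.integral_sum) (intro integrable_mult_left i, simp only: integral_mult_left_zero)
  finally show ?thesis .
qed

lemma tempered_sum:
  assumes \<psi>: "tempered \<psi>" and A: "finite A" and f: "\<And>c. c \<in> A \<Longrightarrow> test_fun (f c)"
  shows "test_fun (\<lambda>x. \<Sum>c\<in>A. w c * f c x) \<and> \<psi> (\<lambda>x. \<Sum>c\<in>A. w c * f c x) = (\<Sum>c\<in>A. w c * \<psi> (f c))"
  using A f
proof (induction A rule: finite_induct)
  case empty
  have t0: "test_fun (\<lambda>x::'a. 0)"
  proof -
    \<comment> \<open>Every point has norm above \<open>-1\<close>, so the vanishing lemma covers
      the whole space.\<close>
    have z: "pdiffs l (\<lambda>x::'a. 0) = (\<lambda>x. 0)" for l
      using pdiffs_eq_0_outside[of "-1" "\<lambda>x. 0" _ l] by (force simp: less_le_trans[OF _ norm_ge_zero])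
    show ?thesis unfolding test_fun_iff smooth_fun_def z by auto
  qed
  \<comment> \<open>The value at the zero function comes from homogeneity with scalar 0.\<close>
  then have "\<psi> (\<lambda>x. 0 * 0) = 0 * \<psi> (\<lambda>x. 0)"
    using \<psi> test_fun_schwartz unfolding tempered_def by meson
  with t0 show ?case by simp
next
  case (insert c A)
  let ?h = "\<lambda>x. \<Sum>c\<in>A. w c * f c x"
  have h: "test_fun ?h" "\<psi> ?h = (\<Sum>c\<in>A. w c * \<psi> (f c))" using insert by auto
  have c: "test_fun (f c)" "test_fun (\<lambda>x. w c * f c x)"
    using insert.prems[of c] test_fun_lincomb[of "f c" "f c" "w c" 0] by auto
  have "test_fun (\<lambda>x. w c * f c x + ?h x)"
    using test_fun_lincomb[OF c(1) h(1), of "w c" 1] by simp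
  moreover have "\<psi> (\<lambda>x. w c * f c x + ?h x) = \<psi> (\<lambda>x. w c * f c x) + \<psi> ?h"
    using \<psi> test_fun_schwartz[OF c(2)] test_fun_schwartz[OF h(1)] unfolding tempered_def by blast
  moreover have "\<psi> (\<lambda>x. w c * f c x) = w c * \<psi> (f c)"
    using \<psi> test_fun_schwartz[OF c(1)] unfolding tempered_def by blast
  ultimately show ?case using insert h by simp
qed

subsection \<open>Convolution with a weakly almost periodic distribution\<close>

text \<open>Riemann sums: replacing \<open>s\<close> by the grid point \<open>grid n s\<close> turns the convolution into a finite
  sum, on which \<open>\<psi>\<close> acts by linearity; the error tends to zero in every Schwartz seminorm.\<close>
lemma dconv_convolution:
  fixes f g :: "'a::euclidean_space \<Rightarrow> complex"
  assumes \<psi>: "tempered \<psi>" and f: "test_fun f" and g: "test_fun g" and F: "dconv \<psi> f \<in> bcontfun"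
  shows "dconv \<psi> (smear g uminus f) t = (LINT s|lborel. g s * dconv \<psi> f (t - s))"
proof -
  obtain S where S: "\<And>s. norm s > S \<Longrightarrow> g s = 0" using g unfolding test_fun_iff by blast
  have S': "norm s \<le> S" if "g s \<noteq> 0" for s using S[of s] that by force
  obtain R where R: "\<And>x. norm x > R \<Longrightarrow> f x = 0" using f unfolding test_fun_iff by blast
  have gi: "integrable lborel g" using g by (rule test_fun_integrable)
  define d where "d = real DIM('a)"
  define q where "q n s = - grid n s" for n and s :: 'a
  have q: "q n \<in> borel_measurable borel" for n unfolding q_def by measurable
  have u: "(uminus :: 'a \<Rightarrow> 'a) \<in> borel_measurable borel" by measurable
  have near: "norm (q n s - (- s)) \<le> d / real (Suc n)" for n s
    using norm_grid_diff[of n s] by (simp add: q_def d_def norm_minus_commute)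
  have near1: "norm (q n s - (- s)) \<le> d" for n s
    using near[of n s] by (rule order_trans) (simp add: d_def field_simps)
  \<comment> \<open>A radius valid for all \<open>n\<close>, and for the limiting shift
    \<open>- s\<close> as well: all Riemann sums and the convolution vanish outside one common
    ball.\<close>
  have qS: "norm (q n s) \<le> S + d" if "g s \<noteq> 0" for n s
    using near1[of n s] S'[OF that] norm_triangle_sub[of "q n s" "- s"] by simp
  have uS: "norm (- s) \<le> S + d" if "g s \<noteq> 0" for s :: 'a
    using S'[OF that] by (simp add: d_def)
  define hn where "hn n = smear g (q n) f" for n
  define h where "h = smear g uminus f"
  have hn: "test_fun (hn n)" for n
    unfolding hn_def by (rule test_fun_smear[OF gi q f qS])
  have h: "test_fun h"
    unfolding h_def by (rule test_fun_smear[OF gi u f uS])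
  \<comment> \<open>The weights are the same before and after applying \<open>\<psi>\<close>, so
    this identity is exact for each \<open>n\<close>.\<close>
  have sum: "dconv \<psi> (hn n) t = (LINT s|lborel. g s * dconv \<psi> f (t - grid n s))" for n
  proof -
    let ?A = "grid n ` cball (0::'a) S"
    let ?w = "\<lambda>c. LINT s|lborel. indicat_real (grid n -` {c}) s *\<^sub>R g s"
    have A: "grid n s \<in> ?A" if "g s \<noteq> 0" for s using S'[OF that] by auto
    have "hn n (t - x) = (\<Sum>c\<in>?A. ?w c * f (t - c - x))" for x
      using integral_finite_range[OF gi grid_measurable finite_grid_image A, of "\<lambda>c. f (t - c - x)"]
      by (simp add: hn_def smear_def q_def algebra_simps)
    then have "dconv \<psi> (hn n) t = \<psi> (\<lambda>x. \<Sum>c\<in>?A. ?w c * f (t - c - x))" by (simp add: dconv_def)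
    also have "\<dots> = (\<Sum>c\<in>?A. ?w c * dconv \<psi> f (t - c))"
      unfolding dconv_def
      by (rule tempered_sum[OF \<psi> finite_grid_image test_fun_reflect[OF f], THEN conjunct2])
    also have "\<dots> = (LINT s|lborel. g s * dconv \<psi> f (t - grid n s))"
      by (rule integral_finite_range[OF gi grid_measurable finite_grid_image A, of "\<lambda>c. dconv \<psi> f (t - c)", symmetric])
    finally show ?thesis .
  qed
  have grid_lim: "(\<lambda>n. grid n s) \<longlonglongrightarrow> s" for s :: 'a
  proof -
    have "(\<lambda>n. grid n s - s) \<longlonglongrightarrow> 0"
    proof (rule Lim_null_comparison)
      show "\<forall>\<^sub>F n in sequentially. norm (grid n s - s) \<le> d / real (Suc n)"
        using norm_grid_diff unfolding d_def by (intro always_eventually allI) blast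
      show "(\<lambda>n. d / real (Suc n)) \<longlonglongrightarrow> 0"
        using tendsto_mult_left[OF LIMSEQ_inverse_real_of_nat, of d] by (simp add: divide_inverse)
    qed
    then show ?thesis by (simp add: LIM_zero_iff)
  qed
  have lim1: "(\<lambda>n. dconv \<psi> (hn n) t) \<longlonglongrightarrow> (LINT s|lborel. g s * dconv \<psi> f (t - s))"
    unfolding sum
  proof -
    obtain B where B: "\<And>x. norm (dconv \<psi> f x) \<le> B" using bcontfun_bound[OF F] by blast
    have [measurable]: "dconv \<psi> f \<in> borel_measurable borel" using F by (rule bcontfun_measurable)
    have [measurable]: "g \<in> borel_measurable borel" using gi by auto
    show "(\<lambda>n. LINT s|lborel. g s * dconv \<psi> f (t - grid n s)) \<longlonglongrightarrow> (LINT s|lborel. g s * dconv \<psi> f (t - s))"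
    proof (rule integral_dominated_convergence[where w = "\<lambda>s. norm (g s) * B"])
      show "AE s in lborel. (\<lambda>n. g s * dconv \<psi> f (t - grid n s)) \<longlonglongrightarrow> g s * dconv \<psi> f (t - s)"
      proof (rule AE_I2, rule tendsto_mult[OF tendsto_const])
        fix s
        have "continuous_on UNIV (dconv \<psi> f)" using F by (simp add: bcontfun_iff)
        then show "(\<lambda>n. dconv \<psi> f (t - grid n s)) \<longlonglongrightarrow> dconv \<psi> f (t - s)"
          by (rule continuous_on_tendsto_compose) (auto intro!: tendsto_intros grid_lim)
      qed
      show "AE s in lborel. norm (g s * dconv \<psi> f (t - grid n s)) \<le> norm (g s) * B" for n
        using B by (auto simp: norm_mult intro!: AE_I2 mult_left_mono)
      show "integrable lborel (\<lambda>s. norm (g s) * B)" using gi by auto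
    qed measurable
  qed
  obtain K k N where K: "K \<ge> 0"
    "\<And>f B. schwartz f \<Longrightarrow> (\<And>l x. set l \<subseteq> Basis \<Longrightarrow> length l \<le> N \<Longrightarrow> (1 + norm x) ^ k * norm (pdiffs l f x) \<le> B)
      \<Longrightarrow> norm (\<psi> f) \<le> K * B"
    using tempered_bound[OF \<psi>] by metis
  \<comment> \<open>The seminorm involves finitely many lists of directions, so one large
    \<open>n\<close> serves all of them.\<close>
  define L where "L = {l :: 'a list. set l \<subseteq> Basis \<and> length l \<le> N}"
  have L: "finite L" unfolding L_def by (rule finite_lists_length_le[OF finite_Basis])
  define I where "I = (LINT s|lborel. norm (g s))"
  have I: "I \<ge> 0" by (simp add: I_def)
  define D where "D n x = 1 * hn n x + (-1) * h x" for n x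
  have D: "test_fun (D n)" for n unfolding D_def by (rule test_fun_lincomb[OF hn h])
  have pD: "pdiffs l (D n) y = smear g (q n) (pdiffs l f) y - smear g uminus (pdiffs l f) y"
    if "set l \<subseteq> Basis" for l n y
    using pdiffs_lincomb[of "hn n" h l 1 "-1"] hn[of n] h that
    unfolding D_def hn_def h_def pdiffs_smear[OF gi q f that] pdiffs_smear[OF gi u f that]
    by (simp add: test_fun_def)
  \<comment> \<open>Each \<open>pdiffs l f\<close> is uniformly continuous and the two shifts differ
    by at most \<open>d / Suc n\<close>, uniformly in \<open>s\<close>; the derivatives of the error
    are therefore uniformly small in space.\<close>
  have small: "eventually (\<lambda>n. \<forall>l\<in>L. \<forall>y. norm (pdiffs l (D n) y) \<le> e * I) sequentially" if e: "e > 0" for e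
  proof (intro eventually_ball_finite[OF L] ballI)
    fix l assume "l \<in> L"
    then have l: "set l \<subseteq> Basis" by (simp add: L_def)
    have lf: "test_fun (pdiffs l f)" using f l by (rule test_fun_pdiffs)
    obtain \<delta> where \<delta>: "\<delta> > 0" "\<And>x y. dist y x < \<delta> \<Longrightarrow> dist (pdiffs l f y) (pdiffs l f x) < e"
      using test_fun_uniformly_continuous[OF lf] e unfolding uniformly_continuous_on_def by (metis UNIV_I)
    have "(\<lambda>n. d / real (Suc n)) \<longlonglongrightarrow> 0"
      using tendsto_mult_left[OF LIMSEQ_inverse_real_of_nat, of d] by (simp add: divide_inverse)
    then have "eventually (\<lambda>n. d / real (Suc n) < \<delta>) sequentially"
      using \<delta>(1) by (rule order_tendstoD)
    then show "eventually (\<lambda>n. \<forall>y. norm (pdiffs l (D n) y) \<le> e * I) sequentially"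
    proof eventually_elim
      case (elim n)
      show ?case unfolding pD[OF l] I_def
      proof (intro allI norm_smear_diff_le[OF gi q u test_fun_bcontfun[OF lf] test_fun_bcontfun[OF lf]])
        fix y s
        have "dist (y + q n s) (y + - s) < \<delta>"
          using near[of n s] elim by (simp add: dist_norm)
        from \<delta>(2)[OF this] show "norm (pdiffs l f (y + q n s) - pdiffs l f (y + - s)) \<le> e"
          by (simp add: dist_norm)
      qed
    qed
  qed
  have supp: "D n x = 0" if "norm x > R + (S + d)" for n x
    using smear_eq_0[of g "q n" "S + d" R f, OF qS R that] smear_eq_0[of g uminus "S + d" R f, OF uS R that]
    by (simp add: D_def hn_def h_def)
  \<comment> \<open>Where \<open>D n (t - x)\<close> can be non-zero,
    \<open>norm x \<le> \<bar>R + (S + d)\<bar> + norm t\<close>; \<open>P\<close> bounds the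
    polynomial weight there independently of \<open>n\<close>.\<close>
  define P where "P = (1 + \<bar>R + (S + d)\<bar> + norm t) ^ k"
  have P: "P > 0" unfolding P_def by (intro zero_less_power) (simp add: add_pos_nonneg)
  have \<psi>D: "norm (\<psi> (\<lambda>x. D n (t - x))) \<le> K * (P * b)"
    if b: "\<And>l y. l \<in> L \<Longrightarrow> norm (pdiffs l (D n) y) \<le> b" for n b
  proof (rule K(2)[OF test_fun_schwartz[OF test_fun_reflect[OF D]]])
    fix l :: "'a list" and x assume l: "set l \<subseteq> Basis" "length l \<le> N"
    then have "l \<in> L" by (simp add: L_def)
    have b0: "b \<ge> 0" using b[OF \<open>l \<in> L\<close>, of 0] norm_ge_zero order_trans by blast
    have eq: "norm (pdiffs l (\<lambda>x. D n (t - x)) x) = norm (pdiffs l (D n) (t - x))"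
      using pdiffs_reflect[of "D n" l t] D[of n] l(1) by (simp add: test_fun_def norm_mult norm_power)
    show "(1 + norm x) ^ k * norm (pdiffs l (\<lambda>x. D n (t - x)) x) \<le> P * b"
    proof (cases "norm (t - x) > R + (S + d)")
      case True
      have "pdiffs l (D n) (t - x) = 0" by (rule pdiffs_eq_0_outside[OF supp True])
      then show ?thesis using b0 P by (simp add: eq)
    next
      case False
      then have "norm x \<le> \<bar>R + (S + d)\<bar> + norm t"
        using norm_triangle_ineq2[of x t] by (simp add: norm_minus_commute)
      then have "(1 + norm x) ^ k \<le> P" unfolding P_def by (intro power_mono) auto
      then show ?thesis unfolding eq using b[OF \<open>l \<in> L\<close>, of "t - x"] P by (intro mult_mono) auto
    qed
  qed
  have diff: "\<psi> (\<lambda>x. D n (t - x)) = dconv \<psi> (hn n) t - dconv \<psi> h t" for n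
  proof -
    have s: "schwartz (\<lambda>x. hn n (t - x))" "schwartz (\<lambda>x. h (t - x))" "schwartz (\<lambda>x. (-1) * h (t - x))"
      using test_fun_reflect[OF hn] test_fun_reflect[OF h]
        test_fun_lincomb[OF test_fun_reflect[OF h] test_fun_reflect[OF h], of "-1" t 0 t]
      by (auto intro: test_fun_schwartz)
    have "\<psi> (\<lambda>x. hn n (t - x) + (-1) * h (t - x)) = \<psi> (\<lambda>x. hn n (t - x)) + \<psi> (\<lambda>x. (-1) * h (t - x))"
      using \<psi> s unfolding tempered_def by blast
    also have "\<psi> (\<lambda>x. (-1) * h (t - x)) = (-1) * \<psi> (\<lambda>x. h (t - x))"
      using \<psi> s unfolding tempered_def by blast
    finally show ?thesis by (simp add: D_def dconv_def)
  qed
  have "(\<lambda>n. \<psi> (\<lambda>x. D n (t - x))) \<longlonglongrightarrow> 0"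
  proof (rule tendstoI)
    fix e :: real assume e: "e > 0"
    define M where "M = K * (P * I)"
    have M: "M \<ge> 0" using K(1) P I by (simp add: M_def)
    define e' where "e' = e / (M + 1)"
    have e': "e' > 0" "M * e' < e" using e M by (simp_all add: e'_def field_simps)
    show "eventually (\<lambda>n. dist (\<psi> (\<lambda>x. D n (t - x))) 0 < e) sequentially"
      using small[OF e'(1)]
    proof eventually_elim
      case (elim n)
      have "norm (\<psi> (\<lambda>x. D n (t - x))) \<le> K * (P * (e' * I))"
        using elim by (intro \<psi>D) blast
      also have "\<dots> = M * e'" by (simp add: M_def)
      finally show ?case using e'(2) by simp
    qed
  qed
  then have lim2: "(\<lambda>n. dconv \<psi> (hn n) t) \<longlonglongrightarrow> dconv \<psi> h t"
    unfolding diff by (simp add: LIM_zero_iff)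
  show ?thesis using LIMSEQ_unique[OF lim2 lim1] by (simp add: h_def)
qed

text \<open>Substitution of \<open>x - s\<close> for \<open>s\<close>, under which Lebesgue measure
  is invariant.\<close>

lemma smear_commute:
  fixes f g :: "'a::euclidean_space \<Rightarrow> complex"
  assumes "test_fun f" "test_fun g"
  shows "smear g uminus f = smear f uminus g"
proof
  fix x
  have [measurable]: "f \<in> borel_measurable borel" "g \<in> borel_measurable borel"
    using assms by (auto intro: bcontfun_measurable test_fun_bcontfun)
  have "(LINT s|lborel. g (x - s) * f (x - (x - s))) = (LINT s|lborel. g s * f (x - s))"
    by (rule lborel_integral_reflect[of "\<lambda>s. g s * f (x - s)" x]) measurable
  then show "smear g uminus f x = smear f uminus g x"
    by (simp add: smear_def mult.commute)
qed

lemma mean_tendsto: "weakly_almost_periodic g \<Longrightarrow> (bavg g \<longlongrightarrow> mean g) at_top"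
  unfolding mean_def ball_avg_eq_bavg
  using weakly_almost_periodic_bavg_convergent tendsto_Lim[OF trivial_limit_at_top_linorder] by metis

lemma mean_dconv_smear:
  fixes f g :: "'a::euclidean_space \<Rightarrow> complex"
  assumes \<psi>: "wap_distribution \<psi>" and f: "test_fun f" and g: "test_fun g"
  shows "mean (dconv \<psi> (smear g uminus f)) = (LINT s|lborel. g s) * mean (dconv \<psi> f)"
proof -
  have wap: "weakly_almost_periodic (dconv \<psi> f)"
    using \<psi> test_fun_schwartz[OF f] by (simp add: wap_distribution_def)
  then have F: "dconv \<psi> f \<in> bcontfun" by (simp add: weakly_almost_periodic_def)
  have gi: "integrable lborel g" using g by (rule test_fun_integrable)
  have eq: "dconv \<psi> (smear g uminus f) = (\<lambda>t. LINT s|lborel. g s * dconv \<psi> f (t - s))"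
    using \<psi> dconv_convolution[OF _ f g F] by (auto simp: wap_distribution_def)
  have "((\<lambda>R. (LINT s|lborel. g s) * bavg (dconv \<psi> f) R) \<longlongrightarrow> (LINT s|lborel. g s) * mean (dconv \<psi> f)) at_top"
    using mean_tendsto[OF wap] by (rule tendsto_mult_left)
  from tendsto_add[OF bavg_convolution_diff[OF F gi] this]
  have "(bavg (dconv \<psi> (smear g uminus f)) \<longlongrightarrow> (LINT s|lborel. g s) * mean (dconv \<psi> f)) at_top"
    unfolding eq by simp
  then show ?thesis
    unfolding mean_def ball_avg_eq_bavg by (rule tendsto_Lim[OF trivial_limit_at_top_linorder])
qed

text \<open>Take \<open>|f|^2\<close>, which unlike the modulus is always smooth. It is non-negative
  and positive on a ball around \<open>x\<close>, so a vanishing integral would make that ball a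
  null set.\<close>

lemma test_fun_nonzero_integral:
  fixes f :: "'a::euclidean_space \<Rightarrow> complex"
  assumes f: "test_fun f" and x: "f x \<noteq> 0"
  obtains g :: "'a \<Rightarrow> complex" where "test_fun g" "(LINT x|lborel. g x) \<noteq> 0"
proof
  define g where "g x = f x * cnj (f x)" for x
  show g: "test_fun g"
    using f smooth_fun_times[of f "\<lambda>x. cnj (f x)"] smooth_fun_cnj[of f]
    unfolding test_fun_iff g_def by fastforce
  have geq: "g x = complex_of_real ((norm (f x))\<^sup>2)" for x
    unfolding g_def using complex_norm_square[of "f x"] by simp
  have cf: "continuous_on UNIV f" using f by (simp add: test_fun_def smooth_fun_step)
  have int: "integrable lborel (\<lambda>x. (norm (f x))\<^sup>2)"
    using test_fun_integrable[OF g] unfolding geq by (simp only: complex_of_real_integrable_eq)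
  have "(LINT x|lborel. (norm (f x))\<^sup>2) \<noteq> 0"
  proof
    assume "(LINT x|lborel. (norm (f x))\<^sup>2) = 0"
    then have "AE x in lborel. (norm (f x))\<^sup>2 = 0"
      using integral_nonneg_eq_0_iff_AE[OF int] by simp
    then have ae: "AE x in lborel. f x = 0" by simp
    have op: "open {x. f x \<noteq> 0}" using cf by (intro open_Collect_neq continuous_on_const)
    have "(AE x in lborel. f x = 0) \<longleftrightarrow> emeasure lborel {x. f x \<noteq> 0} = 0"
      by (rule AE_iff_measurable) (simp_all add: borel_open[OF op])
    then have null: "emeasure lborel {x. f x \<noteq> 0} = 0" using ae by simp
    obtain e where e: "e > 0" "ball x e \<subseteq> {x. f x \<noteq> 0}"
      by (rule openE[OF op, of x]) (use x in simp_all)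
    have "emeasure lborel (ball x e) = 0"
      using emeasure_mono[OF e(2), of lborel] op null by simp
    then have "measure lborel (ball x e) = 0" by (simp add: measure_def)
    with measure_ball_pos[OF e(1), of x] show False by simp
  qed
  then show "(LINT x|lborel. g x) \<noteq> 0"
    unfolding geq integral_complex_of_real by simp
qed

theorem theorem7p1:
  fixes \<psi> :: "('a::euclidean_space \<Rightarrow> complex) \<Rightarrow> complex"
  assumes "wap_distribution \<psi>"
  shows "\<exists>c::complex. \<forall>f::'a \<Rightarrow> complex. test_fun f \<longrightarrow>
           mean (dconv \<psi> f) = c * (LINT x|lborel. f x)"
proof (cases "\<exists>g::'a \<Rightarrow> complex. test_fun g \<and> (LINT x|lborel. g x) \<noteq> 0")
  case True
  then obtain g :: "'a \<Rightarrow> complex" where g: "test_fun g" "(LINT x|lborel. g x) \<noteq> 0" by blast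
  show ?thesis
  proof (intro exI allI impI)
    fix f :: "'a \<Rightarrow> complex" assume f: "test_fun f"
    have "(LINT s|lborel. g s) * mean (dconv \<psi> f) = (LINT s|lborel. f s) * mean (dconv \<psi> g)"
      using mean_dconv_smear[OF assms f g(1)] mean_dconv_smear[OF assms g(1) f] smear_commute[OF f g(1)] by simp
    then show "mean (dconv \<psi> f) = mean (dconv \<psi> g) / (LINT x|lborel. g x) * (LINT x|lborel. f x)"
      using g(2) by (simp add: field_simps)
  qed
next
  case False
  \<comment> \<open>By contraposition of \<open>test_fun_nonzero_integral\<close>, \<open>f\<close>
    is identically zero in this case.\<close>
  have "mean (dconv \<psi> f) = 0" if f: "test_fun f" for f :: "'a \<Rightarrow> complex"
  proof -
    have f0: "f = (\<lambda>x. 0)" using False test_fun_nonzero_integral[OF f] by metis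
    have "\<psi> (\<lambda>x. 0 * f x) = 0 * \<psi> f"
      using assms test_fun_schwartz[OF f] unfolding wap_distribution_def tempered_def by blast
    then have "dconv \<psi> f = (\<lambda>t. 0)" by (simp add: fun_eq_iff dconv_def f0)
    then have "ball_avg (dconv \<psi> f) = (\<lambda>R. 0)" by (simp add: fun_eq_iff ball_avg_def)
    then show ?thesis unfolding mean_def by (simp add: tendsto_Lim)
  qed
  then show ?thesis by (intro exI[of _ 0]) simp
qed

end
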